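(* Let $M$ be a smooth manifold of dimension $2n+1$, $n\geq 1$, let $\eta$ be a contact form on $M$, and let $(\pi,\xi)$ be the Jacobi structure associated with $\eta$. Then the skew algebroid $(T^*M,\sharp_{\pi,\xi},[\cdot,\cdot]_{\pi,\xi}^{\eta})$ is a Lie algebroid isomorphic to the tangent algebroid $(TM,\mathrm{Id},[\cdot,\cdot])$ of $M$.
   Context: A contact form on $M$ is a $1$-form $\eta$ such that $\eta\wedge(d\eta)^{n}$ is a volume form. Then $\flat_\eta:TM\to T^*M$, $\flat_\eta(X)=-i_Xd\eta+\eta(X)\eta$, is a vector bundle isomorphism; let $\sharp_\eta$ be its inverse. The Jacobi structure associated with $\eta$ is $(\pi,\xi)$ with $\pi(\alpha,\beta)=d\eta(\sharp_\eta(\alpha),\sharp_\eta(\beta))$ and $\xi=\sharp_\eta(\eta)$; $\xi$ is the Reeb field, characterized by $i_\xi d\eta=0$, $\eta(\xi)=1$. For a bivector field $\pi$ and a vector field $\xi$ on $M$, define $\sharp_\pi:T^*M\to TM$ by $\beta(\sharp_\pi(\alpha))=\pi(\alpha,\beta)$; $[\alpha,\beta]_\pi=\mathcal{L}_{\sharp_\pi(\alpha)}\beta-\mathcal{L}_{\sharp_\pi(\beta)}\alpha-d(\pi(\alpha,\beta))$; $\sharp_{\pi,\xi}(\alpha)=\sharp_\pi(\alpha)+\alpha(\xi)\xi$; and, for $\lambda\in\Omega^1(M)$ (here $\lambda=\eta$), $$[\alpha,\beta]_{\pi,\xi}^{\lambda}=[\alpha,\beta]_\pi+\alpha(\xi)(\mathcal{L}_\xi\beta-\beta)-\beta(\xi)(\mathcal{L}_\xi\alpha-\alpha)-\pi(\alpha,\beta)\lambda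 .$$ A skew algebroid on $M$ is a triple $(E,\sharp_E,[\cdot,\cdot]_E)$ where $E\to M$ is a vector bundle, $\sharp_E:E\to TM$ is a vector bundle morphism (the anchor), and $[\cdot,\cdot]_E$ is a skew-symmetric $\mathbb{R}$-bilinear bracket on $\Gamma(E)$ with $[s,\varphi t]_E=\varphi[s,t]_E+\sharp_E(s)(\varphi)t$. It is a Lie algebroid if $[\cdot,\cdot]_E$ satisfies the Jacobi identity. An isomorphism of such algebroids is a vector bundle isomorphism over $\mathrm{Id}_M$ compatible with anchors and brackets. *)

theory Defs
  imports "HOL-Analysis.Analysis" "HOL-Combinatorics.Permutations"
begin

section \<open>Smooth manifolds\<close>

primrec Ck_on :: "nat \<Rightarrow> 'a::real_normed_vector set \<Rightarrow> ('a \<Rightarrow> 'b::real_normed_vector) \<Rightarrow> bool" where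
  "Ck_on 0 S f \<longleftrightarrow> continuous_on S f"
| "Ck_on (Suc k) S f \<longleftrightarrow> (\<forall>x\<in>S. f differentiable (at x)) \<and>
     (\<forall>v. Ck_on k S (\<lambda>x. frechet_derivative f (at x) v))"

text \<open>Only used for open \<open>S\<close> in a finite-dimensional space.\<close>

definition smooth_on :: "'a::real_normed_vector set \<Rightarrow> ('a \<Rightarrow> 'b::real_normed_vector) \<Rightarrow> bool" where
  "smooth_on S f \<longleftrightarrow> (\<forall>k. Ck_on k S f)"

type_synonym ('m, 'e) chart = "'m set \<times> ('m \<Rightarrow> 'e)"

definition chart_inv :: "('m, 'e) chart \<Rightarrow> 'e \<Rightarrow> 'm" where
  "chart_inv c = inv_into (fst c) (snd c)"

text \<open>The manifold is the whole type \<open>'m\<close>; Hausdorffness and second countability are carried by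
  its sort. Its dimension is \<open>DIM('e)\<close>. The atlas need not be maximal.\<close>

definition smooth_atlas ::
  "('m::{t2_space,second_countable_topology}, 'e::euclidean_space) chart set \<Rightarrow> bool" where
  "smooth_atlas A \<longleftrightarrow>
     (\<Union>c\<in>A. fst c) = UNIV \<and>
     (\<forall>c\<in>A. open (fst c) \<and> open (snd c ` fst c) \<and>
        homeomorphism (fst c) (snd c ` fst c) (snd c) (chart_inv c)) \<and>
     (\<forall>c\<in>A. \<forall>c'\<in>A. smooth_on (snd c ` (fst c \<inter> fst c')) (snd c' \<circ> chart_inv c))"

definition smooth_map_on ::
  "('m, 'e::euclidean_space) chart set \<Rightarrow> 'm set \<Rightarrow> ('m \<Rightarrow> 'v::real_normed_vector) \<Rightarrow> bool" where
  "smooth_map_on A W f \<longleftrightarrow> (\<forall>c\<in>A. smooth_on (snd c ` (fst c \<inter> W)) (f \<circ> chart_inv c))"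


section \<open>Vector bundles\<close>

text \<open>Every fibre is a copy of the type \<open>'v\<close>. The smooth structure is given by a bundle atlas: a
  set of pairs \<open>(U, \<Phi>)\<close>, where \<open>\<Phi> p\<close> is the linear isomorphism from the fibre at \<open>p\<close> to the typical
  fibre (also \<open>'v\<close>), for \<open>p\<close> in the open set \<open>U\<close>. The identification of the fibre at \<open>p\<close> with \<open>'v\<close>
  need not depend continuously on \<open>p\<close>; in particular the bundle is not assumed to be trivial.\<close>

type_synonym ('m, 'v) vbundle = "('m set \<times> ('m \<Rightarrow> 'v \<Rightarrow> 'v)) set"

definition vector_bundle ::
  "('m::topological_space, 'e::euclidean_space) chart set \<Rightarrow> ('m, 'v::real_normed_vector) vbundle \<Rightarrow> bool"
where
  "vector_bundle A E \<longleftrightarrow>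
     (\<exists>S::'v set. finite S \<and> span S = UNIV) \<and>
     (\<Union>(U, \<Phi>)\<in>E. U) = UNIV \<and>
     (\<forall>(U, \<Phi>)\<in>E. open U \<and> (\<forall>p\<in>U. linear (\<Phi> p) \<and> bij (\<Phi> p))) \<and>
     (\<forall>(U, \<Phi>)\<in>E. \<forall>(V, \<Psi>)\<in>E. \<forall>w. smooth_map_on A (U \<inter> V) (\<lambda>p. \<Psi> p (inv (\<Phi> p) w)))"

definition smooth_section ::
  "('m, 'e::euclidean_space) chart set \<Rightarrow> ('m, 'v::real_normed_vector) vbundle \<Rightarrow> ('m \<Rightarrow> 'v) \<Rightarrow> bool" where
  "smooth_section A E s \<longleftrightarrow> (\<forall>(U, \<Phi>)\<in>E. smooth_map_on A U (\<lambda>p. \<Phi> p (s p)))"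

text \<open>Morphisms over the identity of the base.\<close>

definition vb_morphism ::
  "('m, 'e::euclidean_space) chart set \<Rightarrow> ('m, 'v::real_normed_vector) vbundle \<Rightarrow>
   ('m, 'w::real_normed_vector) vbundle \<Rightarrow> ('m \<Rightarrow> 'v \<Rightarrow> 'w) \<Rightarrow> bool" where
  "vb_morphism A E E' F \<longleftrightarrow>
     (\<forall>p. linear (F p)) \<and>
     (\<forall>(U, \<Phi>)\<in>E. \<forall>(V, \<Psi>)\<in>E'. \<forall>w. smooth_map_on A (U \<inter> V) (\<lambda>p. \<Psi> p (F p (inv (\<Phi> p) w))))"

definition vb_isomorphism ::
  "('m, 'e::euclidean_space) chart set \<Rightarrow> ('m, 'v::real_normed_vector) vbundle \<Rightarrow>
   ('m, 'w::real_normed_vector) vbundle \<Rightarrow> ('m \<Rightarrow> 'v \<Rightarrow> 'w) \<Rightarrow> bool" where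
  "vb_isomorphism A E E' F \<longleftrightarrow>
     vb_morphism A E E' F \<and> (\<forall>p. bij (F p)) \<and> vb_morphism A E' E (\<lambda>p. inv (F p))"


section \<open>Tangent and cotangent bundle\<close>

text \<open>A tangent vector at \<open>p\<close> is represented by its coordinates in one chosen chart around \<open>p\<close>, the
  base chart of \<open>p\<close>, so that each tangent space is a copy of \<open>'e\<close> and each cotangent space a copy of
  the dual of \<open>'e\<close>. The base chart may jump from point to point; smoothness is
  always measured after passing to the coordinates of a chart that does not depend on the point.\<close>

definition base_chart :: "('m, 'e) chart set \<Rightarrow> 'm \<Rightarrow> ('m, 'e) chart" where
  "base_chart A p = (SOME c. c \<in> A \<and> p \<in> fst c)"

text \<open>Jacobian at \<open>p\<close> of the change of coordinates from \<open>c\<close> to \<open>c'\<close>.\<close>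

definition jac :: "('m, 'e::euclidean_space) chart \<Rightarrow> ('m, 'e) chart \<Rightarrow> 'm \<Rightarrow> 'e \<Rightarrow> 'e" where
  "jac c c' p = frechet_derivative (snd c' \<circ> chart_inv c) (at (snd c p))"

definition tcoord :: "('m, 'e::euclidean_space) chart set \<Rightarrow> ('m, 'e) chart \<Rightarrow> 'm \<Rightarrow> 'e \<Rightarrow> 'e" where
  "tcoord A c p v = jac (base_chart A p) c p v"

definition ctcoord ::
  "('m, 'e::euclidean_space) chart set \<Rightarrow> ('m, 'e) chart \<Rightarrow> 'm \<Rightarrow> ('e \<Rightarrow>\<^sub>L real) \<Rightarrow> ('e \<Rightarrow>\<^sub>L real)" where
  "ctcoord A c p a = Blinfun (\<lambda>v. blinfun_apply a (jac c (base_chart A p) p v))"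

definition tangent_bundle :: "('m, 'e::euclidean_space) chart set \<Rightarrow> ('m, 'e) vbundle" where
  "tangent_bundle A = (\<lambda>c. (fst c, tcoord A c)) ` A"

definition cotangent_bundle :: "('m, 'e::euclidean_space) chart set \<Rightarrow> ('m, 'e \<Rightarrow>\<^sub>L real) vbundle" where
  "cotangent_bundle A = (\<lambda>c. (fst c, ctcoord A c)) ` A"

type_synonym ('m, 'e) vfield = "'m \<Rightarrow> 'e"
type_synonym ('m, 'e) oneform = "'m \<Rightarrow> ('e \<Rightarrow>\<^sub>L real)"
type_synonym ('m, 'e) twoform = "'m \<Rightarrow> 'e \<Rightarrow> 'e \<Rightarrow> real"
type_synonym ('m, 'e) bivector = "'m \<Rightarrow> ('e \<Rightarrow>\<^sub>L real) \<Rightarrow> ('e \<Rightarrow>\<^sub>L real) \<Rightarrow> real"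


section \<open>Differential calculus\<close>

definition vfield_rep ::
  "('m, 'e::euclidean_space) chart set \<Rightarrow> ('m, 'e) chart \<Rightarrow> ('m, 'e) vfield \<Rightarrow> 'e \<Rightarrow> 'e" where
  "vfield_rep A c X x = tcoord A c (chart_inv c x) (X (chart_inv c x))"

definition oneform_rep ::
  "('m, 'e::euclidean_space) chart set \<Rightarrow> ('m, 'e) chart \<Rightarrow> ('m, 'e) oneform \<Rightarrow> 'e \<Rightarrow> ('e \<Rightarrow>\<^sub>L real)" where
  "oneform_rep A c \<alpha> x = ctcoord A c (chart_inv c x) (\<alpha> (chart_inv c x))"

text \<open>The operators below are given at \<open>p\<close> by the usual coordinate formulas in the base chart of
  \<open>p\<close>, in which the coordinates of a (co)tangent vector at \<open>p\<close> are the vector itself: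
  \<open>d f = (\<partial>\<^sub>j f) dx\<^sup>j\<close>, \<open>d \<alpha> (u, v) = u\<^sup>i v\<^sup>j (\<partial>\<^sub>i \<alpha>\<^sub>j - \<partial>\<^sub>j \<alpha>\<^sub>i)\<close>,
  \<open>[X, Y]\<^sup>j = X\<^sup>i \<partial>\<^sub>i Y\<^sup>j - Y\<^sup>i \<partial>\<^sub>i X\<^sup>j\<close>, \<open>(\<L>\<^sub>X \<beta>)\<^sub>j = X\<^sup>i \<partial>\<^sub>i \<beta>\<^sub>j + \<beta>\<^sub>i \<partial>\<^sub>j X\<^sup>i\<close>.
  On smooth arguments the results do not depend on the chart.\<close>

definition differential ::
  "('m, 'e::euclidean_space) chart set \<Rightarrow> ('m \<Rightarrow> real) \<Rightarrow> ('m, 'e) oneform" where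
  "differential A f p =
     (let c = base_chart A p in Blinfun (frechet_derivative (f \<circ> chart_inv c) (at (snd c p))))"

definition ext_deriv ::
  "('m, 'e::euclidean_space) chart set \<Rightarrow> ('m, 'e) oneform \<Rightarrow> ('m, 'e) twoform" where
  "ext_deriv A \<alpha> p u v =
     (let c = base_chart A p; D = frechet_derivative (oneform_rep A c \<alpha>) (at (snd c p))
      in blinfun_apply (D u) v - blinfun_apply (D v) u)"

definition lie_bracket ::
  "('m, 'e::euclidean_space) chart set \<Rightarrow> ('m, 'e) vfield \<Rightarrow> ('m, 'e) vfield \<Rightarrow> ('m, 'e) vfield" where
  "lie_bracket A X Y p =
     (let c = base_chart A p
      in frechet_derivative (vfield_rep A c Y) (at (snd c p)) (X p)
       - frechet_derivative (vfield_rep A c X) (at (snd c p)) (Y p))"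

definition lie_deriv ::
  "('m, 'e::euclidean_space) chart set \<Rightarrow> ('m, 'e) vfield \<Rightarrow> ('m, 'e) oneform \<Rightarrow> ('m, 'e) oneform" where
  "lie_deriv A X \<beta> p =
     (let c = base_chart A p
      in Blinfun (\<lambda>v. blinfun_apply (frechet_derivative (oneform_rep A c \<beta>) (at (snd c p)) (X p)) v
                    + blinfun_apply (\<beta> p) (frechet_derivative (vfield_rep A c X) (at (snd c p)) v)))"


section \<open>Skew and Lie algebroids\<close>

type_synonym ('m, 'e, 'v) algebroid =
  "('m, 'v) vbundle \<times> ('m \<Rightarrow> 'v \<Rightarrow> 'e) \<times> (('m \<Rightarrow> 'v) \<Rightarrow> ('m \<Rightarrow> 'v) \<Rightarrow> ('m \<Rightarrow> 'v))"

text \<open>Linearity in the second argument follows from skew-symmetry.\<close>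

fun skew_algebroid ::
  "('m::topological_space, 'e::euclidean_space) chart set \<Rightarrow>
   ('m, 'e, 'v::real_normed_vector) algebroid \<Rightarrow> bool" where
  "skew_algebroid A (E, \<rho>, br) \<longleftrightarrow>
     vector_bundle A E \<and>
     vb_morphism A E (tangent_bundle A) \<rho> \<and>
     (\<forall>s t. smooth_section A E s \<longrightarrow> smooth_section A E t \<longrightarrow> smooth_section A E (br s t)) \<and>
     (\<forall>s t. smooth_section A E s \<longrightarrow> smooth_section A E t \<longrightarrow> (\<forall>p. br s t p = - br t s p)) \<and>
     (\<forall>s s' t a b. smooth_section A E s \<longrightarrow> smooth_section A E s' \<longrightarrow> smooth_section A E t \<longrightarrow>
        (\<forall>p. br (\<lambda>q. a *\<^sub>R s q + b *\<^sub>R s' q) t p = a *\<^sub>R br s t p + b *\<^sub>R br s' t p)) \<and>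
     (\<forall>s t \<phi>. smooth_section A E s \<longrightarrow> smooth_section A E t \<longrightarrow> smooth_map_on A UNIV \<phi> \<longrightarrow>
        (\<forall>p. br s (\<lambda>q. \<phi> q *\<^sub>R t q) p =
             \<phi> p *\<^sub>R br s t p + blinfun_apply (differential A \<phi> p) (\<rho> p (s p)) *\<^sub>R t p))"

fun lie_algebroid ::
  "('m::topological_space, 'e::euclidean_space) chart set \<Rightarrow>
   ('m, 'e, 'v::real_normed_vector) algebroid \<Rightarrow> bool" where
  "lie_algebroid A (E, \<rho>, br) \<longleftrightarrow>
     skew_algebroid A (E, \<rho>, br) \<and>
     (\<forall>s t u. smooth_section A E s \<longrightarrow> smooth_section A E t \<longrightarrow> smooth_section A E u \<longrightarrow>
        (\<forall>p. br s (br t u) p + br t (br u s) p + br u (br s t) p = 0))"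

fun algebroid_isomorphic ::
  "('m, 'e::euclidean_space) chart set \<Rightarrow> ('m, 'e, 'v::real_normed_vector) algebroid \<Rightarrow>
   ('m, 'e, 'w::real_normed_vector) algebroid \<Rightarrow> bool" where
  "algebroid_isomorphic A (E, \<rho>, br) (E', \<rho>', br') \<longleftrightarrow>
     (\<exists>F. vb_isomorphism A E E' F \<and>
        (\<forall>p e. \<rho>' p (F p e) = \<rho> p e) \<and>
        (\<forall>s t. smooth_section A E s \<longrightarrow> smooth_section A E t \<longrightarrow>
           (\<forall>p. F p (br s t p) = br' (\<lambda>q. F q (s q)) (\<lambda>q. F q (t q)) p)))"

definition tangent_algebroid :: "('m, 'e::euclidean_space) chart set \<Rightarrow> ('m, 'e, 'e) algebroid" where
  "tangent_algebroid A = (tangent_bundle A, \<lambda>p. id, lie_bracket A)"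


section \<open>The bracket of one-forms defined by a bivector field and a vector field\<close>

definition sharp_biv :: "('m, 'e::euclidean_space) bivector \<Rightarrow> 'm \<Rightarrow> ('e \<Rightarrow>\<^sub>L real) \<Rightarrow> 'e" where
  "sharp_biv \<pi> p a = (THE v. \<forall>b. blinfun_apply b v = \<pi> p a b)"

definition bracket_biv ::
  "('m, 'e::euclidean_space) chart set \<Rightarrow> ('m, 'e) bivector \<Rightarrow>
   ('m, 'e) oneform \<Rightarrow> ('m, 'e) oneform \<Rightarrow> ('m, 'e) oneform" where
  "bracket_biv A \<pi> \<alpha> \<beta> p =
     lie_deriv A (\<lambda>q. sharp_biv \<pi> q (\<alpha> q)) \<beta> p
     - lie_deriv A (\<lambda>q. sharp_biv \<pi> q (\<beta> q)) \<alpha> p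
     - differential A (\<lambda>q. \<pi> q (\<alpha> q) (\<beta> q)) p"

definition sharp_jac ::
  "('m, 'e::euclidean_space) bivector \<Rightarrow> ('m, 'e) vfield \<Rightarrow> 'm \<Rightarrow> ('e \<Rightarrow>\<^sub>L real) \<Rightarrow> 'e" where
  "sharp_jac \<pi> \<xi> p a = sharp_biv \<pi> p a + blinfun_apply a (\<xi> p) *\<^sub>R \<xi> p"

definition bracket_jac ::
  "('m, 'e::euclidean_space) chart set \<Rightarrow> ('m, 'e) bivector \<Rightarrow> ('m, 'e) vfield \<Rightarrow> ('m, 'e) oneform \<Rightarrow>
   ('m, 'e) oneform \<Rightarrow> ('m, 'e) oneform \<Rightarrow> ('m, 'e) oneform" where
  "bracket_jac A \<pi> \<xi> lam \<alpha> \<beta> p =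
     bracket_biv A \<pi> \<alpha> \<beta> p
     + blinfun_apply (\<alpha> p) (\<xi> p) *\<^sub>R (lie_deriv A \<xi> \<beta> p - \<beta> p)
     - blinfun_apply (\<beta> p) (\<xi> p) *\<^sub>R (lie_deriv A \<xi> \<alpha> p - \<alpha> p)
     - \<pi> p (\<alpha> p) (\<beta> p) *\<^sub>R lam p"


section \<open>Contact forms\<close>

text \<open>An alternating \<open>k\<close>-form on a vector space is a function of a sequence of vectors that only
  looks at the entries \<open>0, \<dots>, k - 1\<close>.\<close>

definition wedge ::
  "nat \<Rightarrow> nat \<Rightarrow> ((nat \<Rightarrow> 'e) \<Rightarrow> real) \<Rightarrow> ((nat \<Rightarrow> 'e) \<Rightarrow> real) \<Rightarrow> (nat \<Rightarrow> 'e) \<Rightarrow> real" where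
  "wedge k l \<omega> \<tau> v =
     (\<Sum>\<sigma> | \<sigma> permutes {..<k + l}.
        of_int (sign \<sigma>) * \<omega> (\<lambda>i. v (\<sigma> i)) * \<tau> (\<lambda>i. v (\<sigma> (k + i)))) / (fact k * fact l)"

primrec wedge_power :: "nat \<Rightarrow> ((nat \<Rightarrow> 'e) \<Rightarrow> real) \<Rightarrow> nat \<Rightarrow> (nat \<Rightarrow> 'e) \<Rightarrow> real" where
  "wedge_power k \<omega> 0 = (\<lambda>v. 1)"
| "wedge_power k \<omega> (Suc j) = wedge k (k * j) \<omega> (wedge_power k \<omega> j)"

definition volume_form :: "nat \<Rightarrow> ('m \<Rightarrow> (nat \<Rightarrow> 'e::euclidean_space) \<Rightarrow> real) \<Rightarrow> bool" where
  "volume_form k \<omega> \<longleftrightarrow> k = DIM('e) \<and> (\<forall>p. \<exists>v. \<omega> p v \<noteq> 0)"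

definition contact_form ::
  "('m, 'e::euclidean_space) chart set \<Rightarrow> nat \<Rightarrow> ('m, 'e) oneform \<Rightarrow> bool" where
  "contact_form A n \<eta> \<longleftrightarrow>
     smooth_section A (cotangent_bundle A) \<eta> \<and>
     volume_form (1 + 2 * n)
       (\<lambda>p. wedge 1 (2 * n) (\<lambda>v. blinfun_apply (\<eta> p) (v 0))
              (wedge_power 2 (\<lambda>v. ext_deriv A \<eta> p (v 0) (v 1)) n))"

definition flat_contact ::
  "('m, 'e::euclidean_space) chart set \<Rightarrow> ('m, 'e) oneform \<Rightarrow> 'm \<Rightarrow> 'e \<Rightarrow> ('e \<Rightarrow>\<^sub>L real)" where
  "flat_contact A \<eta> p v = - Blinfun (\<lambda>w. ext_deriv A \<eta> p v w) + blinfun_apply (\<eta> p) v *\<^sub>R \<eta> p"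

definition sharp_contact ::
  "('m, 'e::euclidean_space) chart set \<Rightarrow> ('m, 'e) oneform \<Rightarrow> 'm \<Rightarrow> ('e \<Rightarrow>\<^sub>L real) \<Rightarrow> 'e" where
  "sharp_contact A \<eta> p = inv (flat_contact A \<eta> p)"

definition contact_biv ::
  "('m, 'e::euclidean_space) chart set \<Rightarrow> ('m, 'e) oneform \<Rightarrow> ('m, 'e) bivector" where
  "contact_biv A \<eta> p a b = ext_deriv A \<eta> p (sharp_contact A \<eta> p a) (sharp_contact A \<eta> p b)"

definition reeb :: "('m, 'e::euclidean_space) chart set \<Rightarrow> ('m, 'e) oneform \<Rightarrow> ('m, 'e) vfield" where
  "reeb A \<eta> p = sharp_contact A \<eta> p (\<eta> p)"

end

theory Submission imports Defs begin

text \<open>The isomorphism with the tangent algebroid is \<open>\<sharp>\<^sub>\<eta>\<close> itself.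

  Let \<open>\<alpha> = \<flat>\<^sub>\<eta> X\<close>, \<open>\<beta> = \<flat>\<^sub>\<eta> Y\<close>, \<open>f = \<eta>(X)\<close> and \<open>g = \<eta>(Y)\<close>. Then \<open>\<pi>(\<alpha>, \<beta>) = d\<eta>(X, Y)\<close>,
  \<open>\<alpha>(\<xi>) = f\<close> and \<open>\<sharp>\<^sub>\<pi> \<alpha> = X - f \<xi>\<close>, so the anchor \<open>\<sharp>\<^sub>\<pi> \<alpha> + \<alpha>(\<xi>) \<xi>\<close> is \<open>X = \<sharp>\<^sub>\<eta> \<alpha>\<close>
  (\<open>sharp_jac_eq_sharp\<close>). For the bracket, \<open>\<L>\<^bsub>X - f \<xi>\<^esub> \<beta> = \<L>\<^sub>X \<beta> - f \<L>\<^sub>\<xi> \<beta> - g df\<close>, so the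
  terms \<open>f \<L>\<^sub>\<xi> \<beta>\<close> and \<open>g \<L>\<^sub>\<xi> \<alpha>\<close> of \<open>[\<alpha>, \<beta>]\<close> cancel. Expanding \<open>\<L>\<^sub>X \<beta> - \<L>\<^sub>Y \<alpha>\<close> by
  Cartan's formula and using \<open>d(d\<eta>) = 0\<close>, everything else collapses to
  \<open>- i d\<eta> + (X(g) - Y(f) - d\<eta>(X, Y)) \<eta>\<close>, the contraction being with \<open>[X, Y]\<close>; the coefficient of \<open>\<eta>\<close>
  is \<open>\<eta>([X, Y])\<close>, and the result is \<open>\<flat>\<^sub>\<eta> [X, Y]\<close> (\<open>bracket_jac_flat\<close>, which rests on its
  coordinate form \<open>eucl_bracket_contact\<close>). Hence \<open>\<sharp>\<^sub>\<eta>\<close> intertwines anchors, brackets and smooth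
  sections, and the Lie algebroid axioms hold on the cotangent bundle because they hold on the
  tangent bundle (\<open>lie_algebroid_transport\<close>).

  Two facts of linear algebra enter. First, \<open>\<flat>\<^sub>\<eta>\<close> is bijective: a vector in its kernel lies in the
  kernels of \<open>\<eta>\<close> and \<open>d\<eta>\<close>, and \<open>\<eta> \<and> (d\<eta>)\<^sup>n\<close> would vanish if it were nonzero
  (\<open>wedge_top_nonzero_imp_kernel_trivial\<close>). Second, \<open>\<sharp>\<^sub>\<eta> \<eta>\<close> has the two defining properties of the
  Reeb field because \<open>d\<eta>\<close> is degenerate in odd dimension (\<open>alternating_odd_dim_kernel\<close>).

  Analytically, the operators are defined at each point in a base chart that may jump from point to
  point, so smoothness and iterated derivatives need the chart independence of the exterior
  derivative and of the Lie bracket. Both follow from the symmetry of second derivatives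
  (\<open>second_derivative_symmetric\<close>) of the transition maps; applied to the coefficients of \<open>\<eta>\<close>, the same symmetry
  is the identity \<open>d(d\<eta>) = 0\<close>.\<close>


section \<open>Calculus of smooth maps\<close>

lemma Ck_on_mono: "Ck_on k S f \<Longrightarrow> T \<subseteq> S \<Longrightarrow> Ck_on k T f"
  by (induction k arbitrary: f) (auto intro: continuous_on_subset)

lemma Ck_on_cong:
  assumes "open S" "\<And>x. x \<in> S \<Longrightarrow> f x = g x" "Ck_on k S f"
  shows "Ck_on k S g"
  using assms
proof (induction k arbitrary: f g)
  case 0
  then show ?case by (metis Ck_on.simps(1) continuous_on_cong)
next
  case (Suc k)
  have d: "(g has_derivative frechet_derivative f (at x)) (at x)" if "x \<in> S" for x
    using Suc.prems that
    by (intro has_derivative_transform_within_open[of f _ x UNIV S g])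
       (auto simp: frechet_derivative_works)
  have "Ck_on k S (\<lambda>x. frechet_derivative g (at x) v)" for v
  proof (rule Suc.IH[OF Suc.prems(1)])
    show "frechet_derivative f (at x) v = frechet_derivative g (at x) v" if "x \<in> S" for x
      using frechet_derivative_at[OF d[OF that]] by simp
    show "Ck_on k S (\<lambda>x. frechet_derivative f (at x) v)"
      using Suc.prems by simp
  qed
  then show ?case using d by (auto simp: differentiable_def)
qed

lemma Ck_on_SucI:
  assumes "open S" "\<And>x. x \<in> S \<Longrightarrow> (f has_derivative f' x) (at x)"
    and "\<And>v. Ck_on k S (\<lambda>x. f' x v)"
  shows "Ck_on (Suc k) S f"
proof -
  have "Ck_on k S (\<lambda>x. frechet_derivative f (at x) v)" for v
    by (rule Ck_on_cong[OF assms(1) _ assms(3)]) (use fun_cong[OF frechet_derivative_at[OF assms(2)]] in blast)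
  then show ?thesis using assms(2) by (auto simp: differentiable_def)
qed

lemma Ck_on_SucD: "Ck_on (Suc k) S f \<Longrightarrow> Ck_on k S f"
proof (induction k arbitrary: f)
  case 0
  then show ?case
    by (auto intro!: continuous_at_imp_continuous_on differentiable_imp_continuous_within)
qed auto

lemma Ck_on_const: "Ck_on k S (\<lambda>x. c)"
  by (induction k arbitrary: c) auto

lemma Ck_on_bounded_linear:
  assumes "bounded_linear L" "open S" "Ck_on k S f"
  shows "Ck_on k S (\<lambda>x. L (f x))"
  using assms(3)
proof (induction k arbitrary: f)
  case 0
  then show ?case using assms(1) by (auto intro: bounded_linear.continuous_on)
next
  case (Suc k)
  show ?case
  proof (rule Ck_on_SucI[OF assms(2)])
    fix x assume "x \<in> S"
    then show "((\<lambda>x. L (f x)) has_derivative (\<lambda>v. L (frechet_derivative f (at x) v))) (at x)"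
      using Suc.prems
      by (intro bounded_linear.has_derivative[OF assms(1)]) (auto simp: frechet_derivative_works)
  qed (use Suc in auto)
qed

lemma Ck_on_add:
  assumes "open S" "Ck_on k S f" "Ck_on k S g"
  shows "Ck_on k S (\<lambda>x. f x + g x)"
  using assms(2,3)
proof (induction k arbitrary: f g)
  case 0
  then show ?case by (auto intro: continuous_on_add)
next
  case (Suc k)
  show ?case
  proof (rule Ck_on_SucI[OF assms(1)])
    fix x assume "x \<in> S"
    then show "((\<lambda>x. f x + g x) has_derivative
        (\<lambda>v. frechet_derivative f (at x) v + frechet_derivative g (at x) v)) (at x)"
      using Suc.prems
      by (intro has_derivative_add) (auto simp: frechet_derivative_works)
  qed (use Suc in auto)
qed

lemma Ck_on_sum:
  assumes "open S" "\<And>i. i \<in> I \<Longrightarrow> Ck_on k S (f i)"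
  shows "Ck_on k S (\<lambda>x. \<Sum>i\<in>I. f i x)"
  using assms(2)
  by (induction I rule: infinite_finite_induct) (auto intro!: Ck_on_const Ck_on_add assms(1))

lemma Ck_on_bilinear:
  assumes "bounded_bilinear B" "open S" "Ck_on k S f" "Ck_on k S g"
  shows "Ck_on k S (\<lambda>x. B (f x) (g x))"
  using assms(3,4)
proof (induction k arbitrary: f g)
  case 0
  then show ?case using assms(1) by (auto intro: bounded_bilinear.continuous_on)
next
  case (Suc k)
  show ?case
  proof (rule Ck_on_SucI[OF assms(2)])
    fix x assume "x \<in> S"
    then show "((\<lambda>x. B (f x) (g x)) has_derivative
        (\<lambda>v. B (f x) (frechet_derivative g (at x) v) + B (frechet_derivative f (at x) v) (g x))) (at x)"
      using Suc.prems
      by (intro bounded_bilinear.FDERIV[OF assms(1)]) (auto simp: frechet_derivative_works)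
  next
    fix v
    show "Ck_on k S (\<lambda>x. B (f x) (frechet_derivative g (at x) v) + B (frechet_derivative f (at x) v) (g x))"
      using Suc.prems Ck_on_SucD[OF Suc.prems(1)] Ck_on_SucD[OF Suc.prems(2)]
      by (intro Ck_on_add[OF assms(2)] Suc.IH) simp_all
  qed
qed

text \<open>The class \<open>C\<^sup>k\<close> is defined through derivatives in fixed directions, whereas the chain rule
  produces a derivative in the moving direction \<open>Df(x) v\<close>. Expanding that direction in an
  orthonormal basis reduces the chain rule to products of functions covered by the induction.\<close>

lemma Ck_on_compose:
  fixes f :: "'a::real_normed_vector \<Rightarrow> 'b::euclidean_space" and g :: "'b \<Rightarrow> 'c::real_normed_vector"
  assumes "open S" "open T" "f ` S \<subseteq> T" "Ck_on k S f" "Ck_on k T g"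
  shows "Ck_on k S (\<lambda>x. g (f x))"
  using assms(4,5)
proof (induction k arbitrary: g)
  case 0
  then show ?case using assms(3) continuous_on_compose2[of T g S f] by simp
next
  case (Suc k)
  let ?D = "\<lambda>x v. \<Sum>b\<in>Basis. (frechet_derivative f (at x) v \<bullet> b) *\<^sub>R frechet_derivative g (at (f x)) b"
  show ?case
  proof (rule Ck_on_SucI[OF assms(1)])
    fix x assume x: "x \<in> S"
    then have df: "(f has_derivative frechet_derivative f (at x)) (at x)"
      and dg: "(g has_derivative frechet_derivative g (at (f x))) (at (f x))"
      using Suc.prems assms(3) by (auto simp: frechet_derivative_works)
    have lin: "linear (frechet_derivative g (at (f x)))"
      using dg has_derivative_bounded_linear bounded_linear.linear by blast
    have "frechet_derivative g (at (f x)) w = (\<Sum>b\<in>Basis. (w \<bullet> b) *\<^sub>R frechet_derivative g (at (f x)) b)" for w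
      using lin by (subst euclidean_representation[of w, symmetric])
        (simp add: linear_sum linear_scale o_def)
    then have "(\<lambda>v. frechet_derivative g (at (f x)) (frechet_derivative f (at x) v)) = ?D x"
      by blast
    then show "((\<lambda>x. g (f x)) has_derivative ?D x) (at x)"
      using has_derivative_compose[OF df dg] by simp
  next
    fix v
    have "Ck_on k S (\<lambda>x. frechet_derivative g (at (f x)) b)" for b
      using Suc.prems Ck_on_SucD[OF Suc.prems(1)] by (intro Suc.IH) simp_all
    then show "Ck_on k S (\<lambda>x. ?D x v)"
      using Suc.prems assms(1)
      by (intro Ck_on_sum Ck_on_bilinear[OF bounded_bilinear_scaleR]
            Ck_on_bounded_linear[OF bounded_linear_inner_left]) auto
  qed
qed

lemma smooth_on_mono: "smooth_on S f \<Longrightarrow> T \<subseteq> S \<Longrightarrow> smooth_on T f"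
  unfolding smooth_on_def using Ck_on_mono by blast

lemma smooth_on_cong:
  "open S \<Longrightarrow> (\<And>x. x \<in> S \<Longrightarrow> f x = g x) \<Longrightarrow> smooth_on S f \<Longrightarrow> smooth_on S g"
  unfolding smooth_on_def using Ck_on_cong[of S f g] by blast

lemma smooth_on_const: "smooth_on S (\<lambda>x. c)"
  unfolding smooth_on_def using Ck_on_const by blast

lemma smooth_on_bounded_linear:
  "bounded_linear L \<Longrightarrow> open S \<Longrightarrow> smooth_on S f \<Longrightarrow> smooth_on S (\<lambda>x. L (f x))"
  unfolding smooth_on_def using Ck_on_bounded_linear by blast

lemma smooth_on_add:
  "open S \<Longrightarrow> smooth_on S f \<Longrightarrow> smooth_on S g \<Longrightarrow> smooth_on S (\<lambda>x. f x + g x)"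
  unfolding smooth_on_def using Ck_on_add by blast

lemma smooth_on_minus: "open S \<Longrightarrow> smooth_on S f \<Longrightarrow> smooth_on S (\<lambda>x. - f x)"
  by (rule smooth_on_bounded_linear[OF bounded_linear_minus[OF bounded_linear_ident]])

lemma smooth_on_diff:
  "open S \<Longrightarrow> smooth_on S f \<Longrightarrow> smooth_on S g \<Longrightarrow> smooth_on S (\<lambda>x. f x - g x)"
  using smooth_on_add[of S f "\<lambda>x. - g x"] smooth_on_minus[of S g] by simp

lemma smooth_on_sum:
  "open S \<Longrightarrow> (\<And>i. i \<in> I \<Longrightarrow> smooth_on S (f i)) \<Longrightarrow> smooth_on S (\<lambda>x. \<Sum>i\<in>I. f i x)"
  by (simp add: smooth_on_def Ck_on_sum)

lemma smooth_on_bilinear: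
  "bounded_bilinear B \<Longrightarrow> open S \<Longrightarrow> smooth_on S f \<Longrightarrow> smooth_on S g \<Longrightarrow> smooth_on S (\<lambda>x. B (f x) (g x))"
  unfolding smooth_on_def using Ck_on_bilinear by blast

lemmas smooth_on_scaleR = smooth_on_bilinear[OF bounded_bilinear_scaleR]
lemmas smooth_on_blinfun_apply = smooth_on_bilinear[OF bounded_bilinear_blinfun_apply]
lemmas smooth_on_blinfun_compose = smooth_on_bilinear[OF bounded_bilinear_blinfun_compose]

lemma smooth_on_compose:
  fixes f :: "'a::real_normed_vector \<Rightarrow> 'b::euclidean_space"
  shows "open S \<Longrightarrow> open T \<Longrightarrow> f ` S \<subseteq> T \<Longrightarrow> smooth_on S f \<Longrightarrow> smooth_on T g \<Longrightarrow> smooth_on S (\<lambda>x. g (f x))"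
  unfolding smooth_on_def using Ck_on_compose by blast

text \<open>Derivatives are packaged as bounded linear maps so that they can be composed and
  differentiated again.\<close>

definition fderiv :: "('a::real_normed_vector \<Rightarrow> 'b::real_normed_vector) \<Rightarrow> 'a \<Rightarrow> 'a \<Rightarrow>\<^sub>L 'b" where
  "fderiv f x = Blinfun (frechet_derivative f (at x))"

lemma fderiv_eqI: "(f has_derivative blinfun_apply L) (at x) \<Longrightarrow> fderiv f x = L"
  unfolding fderiv_def using frechet_derivative_at by (metis blinfun_apply_inverse)

lemma differentiable_fderiv:
  assumes "f differentiable (at x)"
  shows "(f has_derivative blinfun_apply (fderiv f x)) (at x)"
proof -
  have "(f has_derivative frechet_derivative f (at x)) (at x)"
    using assms by (simp add: frechet_derivative_works)
  then show ?thesis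
    unfolding fderiv_def using has_derivative_bounded_linear bounded_linear_Blinfun_apply by fastforce
qed

lemma smooth_on_has_derivative:
  "smooth_on S f \<Longrightarrow> x \<in> S \<Longrightarrow> (f has_derivative blinfun_apply (fderiv f x)) (at x)"
  by (rule differentiable_fderiv) (auto simp: smooth_on_def dest: spec[of _ "Suc 0"])

lemma smooth_on_frechet_derivative:
  "smooth_on S f \<Longrightarrow> x \<in> S \<Longrightarrow> frechet_derivative f (at x) = blinfun_apply (fderiv f x)"
  using smooth_on_has_derivative frechet_derivative_at by metis

lemma dual_basis_expansion:
  fixes a :: "'e::euclidean_space \<Rightarrow>\<^sub>L real"
  shows "(\<Sum>b\<in>Basis. a b *\<^sub>R blinfun_inner_right b) = a"
  by (rule blinfun_euclidean_eqI)
     (simp add: blinfun.sum_left blinfun.scaleR_left inner_Basis if_distrib[of "\<lambda>z. _ * z"] cong: if_cong)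

text \<open>An operator-valued map is the sum over an orthonormal basis of its columns tensored with
  fixed covectors, so smoothness may be tested column by column.\<close>

lemma smooth_on_blinfunI:
  fixes F :: "'c::real_normed_vector \<Rightarrow> 'a::euclidean_space \<Rightarrow>\<^sub>L 'b::real_normed_vector"
  assumes "open S" "\<And>b. smooth_on S (\<lambda>x. F x b)"
  shows "smooth_on S F"
proof -
  let ?L = "\<lambda>b y. blinfun_scaleR_left y o\<^sub>L blinfun_inner_right b"
  have "bounded_linear (?L b)" for b :: 'a
    using bounded_linear_compose[OF
        bounded_bilinear.bounded_linear_left[OF bounded_bilinear_blinfun_compose]
        bounded_linear_blinfun_scaleR_left] .
  moreover have "(\<Sum>b\<in>Basis. ?L b (F x b)) = F x" for x
    by (rule blinfun_euclidean_eqI)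
       (simp add: blinfun.sum_left inner_Basis if_distrib[of "\<lambda>z. z *\<^sub>R _"] cong: if_cong)
  moreover have "smooth_on S (\<lambda>x. \<Sum>b\<in>Basis. ?L b (F x b))"
    using assms calculation(1) by (intro smooth_on_sum smooth_on_bounded_linear[of "?L _"]) auto
  ultimately show ?thesis by simp
qed

lemma smooth_on_fderiv:
  fixes f :: "'a::euclidean_space \<Rightarrow> 'b::real_normed_vector"
  assumes "open S" "smooth_on S f"
  shows "smooth_on S (fderiv f)"
proof (rule smooth_on_blinfunI[OF assms(1)])
  fix b
  have "smooth_on S (\<lambda>x. frechet_derivative f (at x) b)"
    unfolding smooth_on_def
  proof
    fix k
    have "Ck_on (Suc k) S f" using assms(2) unfolding smooth_on_def by blast
    then show "Ck_on k S (\<lambda>x. frechet_derivative f (at x) b)" by simp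
  qed
  then show "smooth_on S (\<lambda>x. fderiv f x b)"
    by (rule smooth_on_cong[OF assms(1), rotated]) (simp add: smooth_on_frechet_derivative[OF assms(2)])
qed


section \<open>Second derivatives and families of inverse operators\<close>

text \<open>Both sides are limits of the second difference
  \<open>f (x + tu + tv) - f (x + tu) - f (x + tv) + f x\<close> divided by \<open>t\<^sup>2\<close>, which is symmetric in \<open>u\<close>
  and \<open>v\<close>. The mean value inequality along \<open>v\<close> bounds its distance to \<open>t\<^sup>2 f''(x)(u, v)\<close>.\<close>

lemma second_derivative_symmetric:
  fixes f :: "'a::real_normed_vector \<Rightarrow> 'b::real_normed_vector"
    and f' :: "'a \<Rightarrow> 'a \<Rightarrow>\<^sub>L 'b" and f'' :: "'a \<Rightarrow>\<^sub>L 'a \<Rightarrow>\<^sub>L 'b"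
  assumes S: "open S" "x \<in> S"
    and f': "\<And>y. y \<in> S \<Longrightarrow> (f has_derivative f' y) (at y)"
    and f'': "(f' has_derivative f'') (at x)"
  shows "f'' u v = f'' v u"
proof -
  define N where "N u v = norm u + norm v" for u v :: 'a
  have N: "N u v \<ge> 0" "norm u \<le> N u v" "norm v \<le> N u v" "N v u = N u v" for u v
    unfolding N_def by auto
  define \<Delta> where "\<Delta> t u v = f (x + t *\<^sub>R u + t *\<^sub>R v) - f (x + t *\<^sub>R u) - f (x + t *\<^sub>R v) + f x" for t u v
  have key: "\<exists>d>0. \<forall>t. 0 < t \<and> t < d \<longrightarrow>
      norm (\<Delta> t u v - (t * t) *\<^sub>R f'' u v) \<le> 2 * e * (t * t) * (N u v * N u v)"
    if e: "e > 0" for e u v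
  proof -
    obtain r where r: "r > 0" "\<And>y. norm (y - x) < r \<Longrightarrow> norm (f' y - f' x - f'' (y - x)) \<le> e * norm (y - x)"
      using f''[unfolded has_derivative_at_alt] e by meson
    obtain r' where r': "r' > 0" "ball x r' \<subseteq> S"
      using S openE by blast
    define d where "d = min r r' / (N u v + 1)"
    have "d > 0" using r r' N by (simp add: d_def add_nonneg_pos)
    moreover have "norm (\<Delta> t u v - (t * t) *\<^sub>R f'' u v) \<le> 2 * e * (t * t) * (N u v * N u v)"
      if t: "0 < t" "t < d" for t
    proof -
      have tN: "t * N u v < min r r'"
      proof -
        have "t * N u v \<le> t * (N u v + 1)" using t by simp
        also have "\<dots> < d * (N u v + 1)" using t N(1)[of u v] by (intro mult_strict_right_mono) auto
        also have "\<dots> = min r r'" using N(1)[of u v] by (simp add: d_def)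
        finally show ?thesis .
      qed
      have nrm: "norm (c *\<^sub>R u + s *\<^sub>R v) \<le> t * N u v" if "c \<in> {0, t}" "s \<in> {0..t}" for c s
      proof -
        have "norm (c *\<^sub>R u + s *\<^sub>R v) \<le> \<bar>c\<bar> * norm u + \<bar>s\<bar> * norm v"
          using norm_triangle_ineq[of "c *\<^sub>R u" "s *\<^sub>R v"] by simp
        also have "\<dots> \<le> t * norm u + t * norm v"
          using that t by (intro add_mono mult_right_mono) auto
        finally show ?thesis by (simp add: N_def distrib_left)
      qed
      let ?y = "\<lambda>c s. x + c *\<^sub>R u + s *\<^sub>R v"
      have y: "norm (?y c s - x) \<le> t * N u v" if "c \<in> {0, t}" "s \<in> {0..t}" for c s
        using nrm[OF that] by (simp add: algebra_simps)
      have yS: "?y c s \<in> S" if "c \<in> {0, t}" "s \<in> {0..t}" for c s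
        using y[OF that] tN r'(2) by (auto simp: dist_norm norm_minus_commute subset_iff)
      have yr: "norm (f' (?y c s) - f' x - f'' (?y c s - x)) \<le> e * (t * N u v)"
        if "c \<in> {0, t}" "s \<in> {0..t}" for c s
        using r(2)[of "?y c s"] y[OF that] tN e
        by (smt (verit) mult_left_mono)
      \<comment> \<open>The second difference is the increment over \<open>[0, t]\<close> of \<open>s \<mapsto> f (x + tu + sv) - f (x + sv)\<close>.\<close>
      let ?h = "\<lambda>s. f (?y t s) - f (?y 0 s) - (s * t) *\<^sub>R f'' u v"
      let ?h' = "\<lambda>s. f' (?y t s) v - f' (?y 0 s) v - t *\<^sub>R f'' u v"
      have "norm (?h t - ?h 0) \<le> (2 * e * (t * N u v) * norm v) * norm (t - 0)"
      proof (rule differentiable_bound[of "{0..t}" ?h "\<lambda>s z. z *\<^sub>R ?h' s"])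
        fix s assume s: "s \<in> {0..t}"
        have A: "((\<lambda>s. f (?y c s)) has_derivative (\<lambda>z. f' (?y c s) (z *\<^sub>R v))) (at s within {0..t})"
          if "c \<in> {0, t}" for c
          by (rule has_derivative_compose[of "\<lambda>s. ?y c s" "\<lambda>z. z *\<^sub>R v" s "{0..t}" f, OF _ f'[OF yS[OF that s]]])
             (auto intro!: derivative_eq_intros)
        show "(?h has_derivative (\<lambda>z. z *\<^sub>R ?h' s)) (at s within {0..t})"
          by (rule derivative_eq_intros A refl | simp)+
             (auto simp: blinfun.scaleR_right algebra_simps)
        have "?h' s = ((f' (?y t s) - f' x - f'' (?y t s - x)) - (f' (?y 0 s) - f' x - f'' (?y 0 s - x))) v"
          by (simp add: blinfun.bilinear_simps)
        also have "norm \<dots> \<le> norm ((f' (?y t s) - f' x - f'' (?y t s - x)) - (f' (?y 0 s) - f' x - f'' (?y 0 s - x))) * norm v"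
          by (rule norm_blinfun)
        also have "\<dots> \<le> (e * (t * N u v) + e * (t * N u v)) * norm v"
          using s by (intro mult_right_mono[OF order.trans[OF norm_triangle_ineq4 add_mono]] yr) auto
        finally have "norm (?h' s) \<le> 2 * e * (t * N u v) * norm v" by (simp add: algebra_simps)
        then show "onorm (\<lambda>z. z *\<^sub>R ?h' s) \<le> 2 * e * (t * N u v) * norm v"
          by (simp add: onorm_scaleR_left bounded_linear_ident onorm_id)
      qed (use t in auto)
      also have "?h t - ?h 0 = \<Delta> t u v - (t * t) *\<^sub>R f'' u v"
        by (simp add: \<Delta>_def)
      also have "(2 * e * (t * N u v) * norm v) * norm (t - 0) \<le> 2 * e * (t * t) * (N u v * N u v)"
      proof -
        have "2 * e * (t * t) * N u v * norm v \<le> 2 * e * (t * t) * N u v * N u v"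
          using N(1)[of u v] e t by (intro mult_left_mono N(3)) auto
        then show ?thesis using t by (simp add: mult_ac)
      qed
      finally show ?thesis .
    qed
    ultimately show ?thesis by blast
  qed
  have sym: "\<Delta> t u v = \<Delta> t v u" for t
    unfolding \<Delta>_def by (simp add: add_ac)
  have "norm (f'' u v - f'' v u) \<le> 0 + e" if "e > 0" for e
  proof -
    define e' where "e' = e / (4 * (N u v * N u v + 1))"
    have e': "e' > 0" using that by (simp add: e'_def add_nonneg_pos)
    obtain d1 d2 where d: "d1 > 0" "d2 > 0"
      and k: "\<And>t. 0 < t \<Longrightarrow> t < d1 \<Longrightarrow> norm (\<Delta> t u v - (t * t) *\<^sub>R f'' u v) \<le> 2 * e' * (t * t) * (N u v * N u v)"
        "\<And>t. 0 < t \<Longrightarrow> t < d2 \<Longrightarrow> norm (\<Delta> t v u - (t * t) *\<^sub>R f'' v u) \<le> 2 * e' * (t * t) * (N v u * N v u)"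
      using key[OF e', of u v] key[OF e', of v u] by metis
    define t where "t = min d1 d2 / 2"
    have t: "0 < t" "t < d1" "t < d2" using d by (auto simp: t_def)
    have "(t * t) * norm (f'' u v - f'' v u) = norm ((t * t) *\<^sub>R (f'' u v - f'' v u))"
      by simp
    also have "\<dots> = norm ((\<Delta> t v u - (t * t) *\<^sub>R f'' v u) - (\<Delta> t u v - (t * t) *\<^sub>R f'' u v))"
      unfolding sym by (simp add: algebra_simps)
    also have "\<dots> \<le> 2 * e' * (t * t) * (N u v * N u v) + 2 * e' * (t * t) * (N u v * N u v)"
      using k(1)[OF t(1,2)] k(2)[OF t(1,3)] N(4)[of u v]
      by (intro order.trans[OF norm_triangle_ineq4]) auto
    also have "\<dots> = (t * t) * (4 * e' * (N u v * N u v))" by simp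
    finally have "norm (f'' u v - f'' v u) \<le> 4 * e' * (N u v * N u v)" using t by simp
    also have "\<dots> \<le> 4 * e' * (N u v * N u v + 1)" using e' by simp
    also have "\<dots> = e"
    proof -
      have "4 * (e / (4 * c)) * c = e" if "c > 0" for c :: real using that by simp
      from this[of "N u v * N u v + 1"] show ?thesis by (simp add: e'_def add_nonneg_pos)
    qed
    finally show ?thesis by simp
  qed
  then have "norm (f'' u v - f'' v u) \<le> 0" by (rule field_le_epsilon)
  then show ?thesis by simp
qed

lemma fderiv_fderiv_symmetric:
  fixes f :: "'a::euclidean_space \<Rightarrow> 'b::real_normed_vector"
  assumes "open S" "smooth_on S f" "x \<in> S"
  shows "fderiv (fderiv f) x u v = fderiv (fderiv f) x v u"
  using assms(1,3) smooth_on_has_derivative[OF assms(2)]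
    smooth_on_has_derivative[OF smooth_on_fderiv[OF assms(1,2)] assms(3)]
  by (rule second_derivative_symmetric)

text \<open>A product rule in which one factor need only be continuous, because the other one vanishes at
  the point.\<close>

lemma has_derivative_bilinear_vanishing:
  fixes B :: "'b::real_normed_vector \<Rightarrow> 'c::real_normed_vector \<Rightarrow> 'd::real_normed_vector"
    and h :: "'a::real_normed_vector \<Rightarrow> 'c"
  assumes B: "bounded_bilinear B" and g: "isCont g x"
    and h: "(h has_derivative h') (at x)" "h x = 0"
  shows "((\<lambda>y. B (g y) (h y)) has_derivative (\<lambda>v. B (g x) (h' v))) (at x)"
proof -
  interpret B: bounded_bilinear B by fact
  have h'0: "bounded_linear h'" using h(1) by (rule has_derivative_bounded_linear)
  obtain K where K: "K > 0" "\<And>v. norm (h' v) \<le> norm v * K"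
    using bounded_linear.pos_bounded[OF h'0] by blast
  have lim0: "((\<lambda>y. (1 / norm (y - x)) *\<^sub>R (h y - (h x + h' (y - x)))) \<longlongrightarrow> 0) (at x)"
    using h(1) unfolding has_derivative_within by blast
  have gx: "(g \<longlongrightarrow> g x) (at x)" using g by (simp add: isCont_def)
  have "((\<lambda>y. B (g y) ((1 / norm (y - x)) *\<^sub>R (h y - (h x + h' (y - x))))) \<longlongrightarrow> B (g x) 0) (at x)"
    by (rule B.tendsto[OF gx lim0])
  moreover have "((\<lambda>y. B (g y - g x) ((1 / norm (y - x)) *\<^sub>R h' (y - x))) \<longlongrightarrow> 0) (at x)"
  proof -
    obtain C where C: "C > 0" "\<And>a b. norm (B a b) \<le> norm a * norm b * C"
      using B.pos_bounded by blast
    have "norm (B (g y - g x) ((1 / norm (y - x)) *\<^sub>R h' (y - x))) \<le> norm (g y - g x) * (K * C)"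
      if "y \<noteq> x" for y
    proof -
      have "norm ((1 / norm (y - x)) *\<^sub>R h' (y - x)) \<le> K"
        using K(2)[of "y - x"] that by (simp add: field_simps)
      then have "norm (g y - g x) * norm ((1 / norm (y - x)) *\<^sub>R h' (y - x)) * C \<le> norm (g y - g x) * K * C"
        using C(1) by (intro mult_right_mono mult_left_mono) auto
      with C(2)[of "g y - g x" "(1 / norm (y - x)) *\<^sub>R h' (y - x)"] show ?thesis
        by (simp add: mult.assoc)
    qed
    then have "\<forall>\<^sub>F y in at x. norm (B (g y - g x) ((1 / norm (y - x)) *\<^sub>R h' (y - x))) \<le> norm (g y - g x) * (K * C)"
      by (simp add: eventually_at_filter)
    moreover have "((\<lambda>y. g y - g x) \<longlongrightarrow> 0) (at x)" using gx by (simp add: LIM_zero)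
    ultimately show ?thesis by (rule tendsto_0_le[rotated])
  qed
  ultimately have "((\<lambda>y. B (g y) ((1 / norm (y - x)) *\<^sub>R (h y - (h x + h' (y - x)))) +
      B (g y - g x) ((1 / norm (y - x)) *\<^sub>R h' (y - x))) \<longlongrightarrow> B (g x) 0 + 0) (at x)"
    by (rule tendsto_add)
  moreover have "B (g y) ((1 / norm (y - x)) *\<^sub>R (h y - (h x + h' (y - x)))) +
      B (g y - g x) ((1 / norm (y - x)) *\<^sub>R h' (y - x)) =
      (1 / norm (y - x)) *\<^sub>R (B (g y) (h y) - (B (g x) (h x) + B (g x) (h' (y - x))))" for y
    using h(2) by (simp add: B.scaleR_right B.diff_right B.diff_left B.zero_right algebra_simps)
  ultimately show ?thesis
    unfolding has_derivative_within
    using bounded_linear_compose[OF B.bounded_linear_right h'0] by (simp add: B.zero_right)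
qed

text \<open>The identity \<open>\<Psi> y = \<Psi> x - \<Psi> y (\<Phi> y - \<Phi> x) \<Psi> x\<close> shows that \<open>\<Psi>\<close> is continuous, then
  that it has the derivative \<open>- \<Psi> x (D\<Phi> x v) \<Psi> x\<close>; this formula involves only \<open>\<Psi>\<close> itself
  and \<open>D\<Phi>\<close>, hence propagates \<open>C\<^sup>k\<close> regularity to \<open>C\<^sup>k\<^sup>+\<^sup>1\<close>.\<close>

lemma smooth_on_inverse_family:
  fixes \<Phi> :: "'a::real_normed_vector \<Rightarrow> 'v::real_normed_vector \<Rightarrow>\<^sub>L 'w::real_normed_vector"
    and \<Psi> :: "'a \<Rightarrow> 'w \<Rightarrow>\<^sub>L 'v"
  assumes S: "open S" and \<Phi>: "smooth_on S \<Phi>"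
    and inv: "\<And>x v. x \<in> S \<Longrightarrow> \<Psi> x (\<Phi> x v) = v" "\<And>x w. x \<in> S \<Longrightarrow> \<Phi> x (\<Psi> x w) = w"
  shows "smooth_on S \<Psi>"
proof -
  note comp = bounded_bilinear_blinfun_compose
  have id: "\<Psi> y = \<Psi> x - (\<Psi> y o\<^sub>L ((\<Phi> y - \<Phi> x) o\<^sub>L \<Psi> x))" if "x \<in> S" "y \<in> S" for x y
    using that by (intro blinfun_eqI) (simp add: blinfun.bilinear_simps inv)
  have d\<Phi>: "(\<Phi> has_derivative fderiv \<Phi> x) (at x)" if "x \<in> S" for x
    using smooth_on_has_derivative[OF \<Phi> that] .
  have cont: "isCont \<Psi> x" if x: "x \<in> S" for x
  proof -
    have lim: "((\<lambda>y. norm (\<Phi> y - \<Phi> x)) \<longlongrightarrow> 0) (at x)"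
      using has_derivative_continuous[OF d\<Phi>[OF x]]
      by (simp add: continuous_within tendsto_norm_zero LIM_zero)
    \<comment> \<open>Where this product is below one half, the identity above yields \<open>\<parallel>\<Psi> y\<parallel> \<le> 2 \<parallel>\<Psi> x\<parallel>\<close>.\<close>
    have "\<forall>\<^sub>F y in at x. norm (\<Phi> y - \<Phi> x) * norm (\<Psi> x) < 1 / 2"
      by (rule order_tendstoD(2)[of _ 0]) (use tendsto_mult_left_zero[OF lim] in auto)
    moreover have "\<forall>\<^sub>F y in at x. y \<in> S"
      using S x by (simp add: eventually_at_in_open')
    ultimately have "\<forall>\<^sub>F y in at x. norm (\<Psi> y - \<Psi> x) \<le> norm (\<Phi> y - \<Phi> x) * (2 * norm (\<Psi> x) * norm (\<Psi> x))"
    proof eventually_elim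
      case (elim y)
      have "norm (\<Psi> y - \<Psi> x) = norm (\<Psi> y o\<^sub>L ((\<Phi> y - \<Phi> x) o\<^sub>L \<Psi> x))"
        by (subst id[OF x elim(2)]) simp
      also have "\<dots> \<le> norm (\<Psi> y) * (norm (\<Phi> y - \<Phi> x) * norm (\<Psi> x))"
        by (rule order.trans[OF norm_blinfun_compose]) (simp add: mult_left_mono norm_blinfun_compose)
      finally have a: "norm (\<Psi> y - \<Psi> x) \<le> norm (\<Psi> y) * (norm (\<Phi> y - \<Phi> x) * norm (\<Psi> x))" .
      also have "\<dots> \<le> norm (\<Psi> y) * (1 / 2)"
        using elim(1) by (intro mult_left_mono) auto
      finally have "norm (\<Psi> y) \<le> 2 * norm (\<Psi> x)"
        using norm_triangle_ineq2[of "\<Psi> y" "\<Psi> x"] by simp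
      then have "norm (\<Psi> y) * (norm (\<Phi> y - \<Phi> x) * norm (\<Psi> x)) \<le> 2 * norm (\<Psi> x) * (norm (\<Phi> y - \<Phi> x) * norm (\<Psi> x))"
        by (intro mult_right_mono) auto
      with a show ?case by (simp add: mult_ac)
    qed
    then have "((\<lambda>y. \<Psi> y - \<Psi> x) \<longlongrightarrow> 0) (at x)"
      by (rule tendsto_0_le[OF tendsto_norm_zero_cancel[OF lim], where K = "2 * norm (\<Psi> x) * norm (\<Psi> x)", rotated]) 
    then show ?thesis by (simp add: isCont_def LIM_zero_iff)
  qed
  have d\<Psi>: "(\<Psi> has_derivative (\<lambda>v. - (\<Psi> x o\<^sub>L (fderiv \<Phi> x v o\<^sub>L \<Psi> x)))) (at x)" if x: "x \<in> S" for x
  proof -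
    have "((\<lambda>y. (\<Phi> y - \<Phi> x) o\<^sub>L \<Psi> x) has_derivative (\<lambda>v. fderiv \<Phi> x v o\<^sub>L \<Psi> x)) (at x)"
      using d\<Phi>[OF x]
      by (intro bounded_linear.has_derivative[OF bounded_bilinear.bounded_linear_left[OF comp]])
         (auto intro!: derivative_eq_intros)
    from has_derivative_bilinear_vanishing[OF comp cont[OF x] this]
    have "((\<lambda>y. \<Psi> y o\<^sub>L ((\<Phi> y - \<Phi> x) o\<^sub>L \<Psi> x)) has_derivative
        (\<lambda>v. \<Psi> x o\<^sub>L (fderiv \<Phi> x v o\<^sub>L \<Psi> x))) (at x)" by simp
    then have "((\<lambda>y. \<Psi> x - (\<Psi> y o\<^sub>L ((\<Phi> y - \<Phi> x) o\<^sub>L \<Psi> x))) has_derivative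
        (\<lambda>v. - (\<Psi> x o\<^sub>L (fderiv \<Phi> x v o\<^sub>L \<Psi> x)))) (at x)"
      using has_derivative_diff[OF has_derivative_const] by fastforce
    then show ?thesis
      by (rule has_derivative_transform_within_open[OF _ S x]) (use id[OF x] in metis)
  qed
  have "Ck_on k S \<Psi>" for k
  proof (induction k)
    case 0
    then show ?case using cont by (auto intro: continuous_at_imp_continuous_on)
  next
    case (Suc k)
    have "Ck_on k S (\<lambda>x. fderiv \<Phi> x v)" for v
    proof (rule Ck_on_cong[OF S])
      have "Ck_on (Suc k) S \<Phi>" using \<Phi> unfolding smooth_on_def by blast
      then show "Ck_on k S (\<lambda>x. frechet_derivative \<Phi> (at x) v)" by simp
    qed (simp add: smooth_on_frechet_derivative[OF \<Phi>])
    then have "Ck_on k S (\<lambda>x. \<Psi> x o\<^sub>L (fderiv \<Phi> x v o\<^sub>L \<Psi> x))" for v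
      by (intro Ck_on_bilinear[OF comp S] Suc)
    then show ?case
      by (intro Ck_on_SucI[OF S d\<Psi>] Ck_on_bounded_linear[OF bounded_linear_minus[OF bounded_linear_ident] S])
  qed
  then show ?thesis by (simp add: smooth_on_def)
qed

section \<open>Exterior derivative and Lie bracket on open sets of a Euclidean space\<close>

definition eucl_ext_deriv :: "('e::euclidean_space \<Rightarrow> 'e \<Rightarrow>\<^sub>L real) \<Rightarrow> 'e \<Rightarrow> 'e \<Rightarrow> 'e \<Rightarrow> real" where
  "eucl_ext_deriv a x u v = fderiv a x u v - fderiv a x v u"

definition eucl_bracket :: "('e::euclidean_space \<Rightarrow> 'e) \<Rightarrow> ('e \<Rightarrow> 'e) \<Rightarrow> 'e \<Rightarrow> 'e" where
  "eucl_bracket X Y x = fderiv Y x (X x) - fderiv X x (Y x)"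

lemma fderiv_transform:
  assumes "(f has_derivative blinfun_apply L) (at x)" "open S" "x \<in> S" "\<And>y. y \<in> S \<Longrightarrow> g y = f y"
  shows "fderiv g x = L"
  by (rule fderiv_eqI, rule has_derivative_transform_within_open[OF assms(1-3)]) (simp add: assms(4))

lemma fderiv_apply_eqI:
  assumes "(f has_derivative f') (at x)"
  shows "fderiv f x u = f' u"
  unfolding fderiv_def
  using assms frechet_derivative_at[OF assms] has_derivative_bounded_linear[OF assms]
  by (simp add: bounded_linear_Blinfun_apply)

lemma fderiv_apply_transform:
  assumes "(f has_derivative f') (at x)" "open S" "x \<in> S" "\<And>y. y \<in> S \<Longrightarrow> f y = g y"
  shows "fderiv g x u = f' u"
  by (rule fderiv_apply_eqI, rule has_derivative_transform_within_open[OF assms(1-3)])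
     (simp add: assms(4))

text \<open>The second derivative of the transition map \<open>\<tau>\<close> enters both transformation laws
  symmetrically in the two arguments, so it cancels in the antisymmetrized expressions.\<close>

lemma eucl_ext_deriv_pullback:
  assumes S: "open S" "x \<in> S" and \<tau>: "smooth_on S \<tau>" "\<tau> x \<in> T" and b: "smooth_on T b"
    and ab: "\<And>y. y \<in> S \<Longrightarrow> a y = b (\<tau> y) o\<^sub>L fderiv \<tau> y"
  shows "eucl_ext_deriv a x u v = eucl_ext_deriv b (\<tau> x) (fderiv \<tau> x u) (fderiv \<tau> x v)"
proof -
  have d\<tau>: "(\<tau> has_derivative fderiv \<tau> x) (at x)"
    and d2\<tau>: "(fderiv \<tau> has_derivative fderiv (fderiv \<tau>) x) (at x)"
    using smooth_on_has_derivative smooth_on_fderiv S \<tau> by blast+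
  have db: "((\<lambda>y. b (\<tau> y)) has_derivative (\<lambda>u. fderiv b (\<tau> x) (fderiv \<tau> x u))) (at x)"
    by (rule has_derivative_compose[OF d\<tau> smooth_on_has_derivative[OF b \<tau>(2)]])
  have "((\<lambda>y. b (\<tau> y) o\<^sub>L fderiv \<tau> y) has_derivative
      (\<lambda>u. (b (\<tau> x) o\<^sub>L fderiv (fderiv \<tau>) x u) + (fderiv b (\<tau> x) (fderiv \<tau> x u) o\<^sub>L fderiv \<tau> x))) (at x)"
    by (rule bounded_bilinear.FDERIV[OF bounded_bilinear_blinfun_compose db d2\<tau>])
  from fderiv_apply_transform[OF this S] ab
  have "fderiv a x u = (b (\<tau> x) o\<^sub>L fderiv (fderiv \<tau>) x u) + (fderiv b (\<tau> x) (fderiv \<tau> x u) o\<^sub>L fderiv \<tau> x)" for u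
    by simp
  then show ?thesis
    unfolding eucl_ext_deriv_def
    by (simp add: blinfun.bilinear_simps fderiv_fderiv_symmetric[OF S(1) \<tau>(1) S(2), of u v])
qed

lemma eucl_bracket_pushforward:
  assumes S: "open S" "x \<in> S" and T: "\<tau> x \<in> T" and \<tau>: "smooth_on S \<tau>"
    and X: "smooth_on S X" "smooth_on T X'" "\<And>y. y \<in> S \<Longrightarrow> X' (\<tau> y) = fderiv \<tau> y (X y)"
    and Y: "smooth_on S Y" "smooth_on T Y'" "\<And>y. y \<in> S \<Longrightarrow> Y' (\<tau> y) = fderiv \<tau> y (Y y)"
  shows "eucl_bracket X' Y' (\<tau> x) = fderiv \<tau> x (eucl_bracket X Y x)"
proof -
  have d\<tau>: "(\<tau> has_derivative fderiv \<tau> x) (at x)"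
    and d2\<tau>: "(fderiv \<tau> has_derivative fderiv (fderiv \<tau>) x) (at x)"
    using smooth_on_has_derivative smooth_on_fderiv S \<tau> by blast+
  have *: "fderiv Y' (\<tau> x) (fderiv \<tau> x u) = fderiv \<tau> x (fderiv Y x u) + fderiv (fderiv \<tau>) x u (Y x)"
    if Y: "smooth_on S Y" "smooth_on T Y'" "\<And>y. y \<in> S \<Longrightarrow> Y' (\<tau> y) = fderiv \<tau> y (Y y)" for Y Y' u
  proof -
    have 1: "((\<lambda>y. Y' (\<tau> y)) has_derivative (\<lambda>u. fderiv Y' (\<tau> x) (fderiv \<tau> x u))) (at x)"
      by (rule has_derivative_compose[OF d\<tau> smooth_on_has_derivative[OF Y(2) T]])
    have 2: "((\<lambda>y. fderiv \<tau> y (Y y)) has_derivative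
        (\<lambda>u. fderiv \<tau> x (fderiv Y x u) + fderiv (fderiv \<tau>) x u (Y x))) (at x)"
      by (rule bounded_bilinear.FDERIV[OF bounded_bilinear_blinfun_apply d2\<tau> smooth_on_has_derivative[OF Y(1) S(2)]])
    show ?thesis
      using fderiv_apply_transform[OF 1 S Y(3)] fderiv_apply_eqI[OF 2] by simp
  qed
  show ?thesis
    unfolding eucl_bracket_def X(3)[OF S(2)] Y(3)[OF S(2)]
    using *[OF X, of "Y x"] *[OF Y, of "X x"]
    by (simp add: blinfun.bilinear_simps fderiv_fderiv_symmetric[OF S(1) \<tau> S(2), of "X x" "Y x"])
qed

lemma eucl_bracket_cong:
  assumes "open S" "x \<in> S" "\<And>y. y \<in> S \<Longrightarrow> Y y = Y' y" "smooth_on S Y'"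
  shows "eucl_bracket X Y x = eucl_bracket X Y' x"
  using fderiv_transform[OF smooth_on_has_derivative[OF assms(4,2)] assms(1-3)] assms(3)[OF assms(2)]
  by (simp add: eucl_bracket_def)

lemma smooth_on_eucl_bracket:
  assumes "open S" "smooth_on S X" "smooth_on S Y"
  shows "smooth_on S (eucl_bracket X Y)"
  unfolding eucl_bracket_def
  using assms by (intro smooth_on_diff smooth_on_blinfun_apply smooth_on_fderiv)

lemma eucl_bracket_Jacobi:
  assumes S: "open S" "x \<in> S" and X: "smooth_on S X" and Y: "smooth_on S Y" and Z: "smooth_on S Z"
  shows "eucl_bracket X (eucl_bracket Y Z) x + eucl_bracket Y (eucl_bracket Z X) x
    + eucl_bracket Z (eucl_bracket X Y) x = 0"
proof -
  have *: "fderiv (eucl_bracket Y Z) x u =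
      fderiv Z x (fderiv Y x u) + fderiv (fderiv Z) x u (Y x)
      - (fderiv Y x (fderiv Z x u) + fderiv (fderiv Y) x u (Z x))"
    if Y: "smooth_on S Y" and Z: "smooth_on S Z" for Y Z u
    unfolding eucl_bracket_def
    by (rule fderiv_apply_eqI has_derivative_diff
         bounded_bilinear.FDERIV[OF bounded_bilinear_blinfun_apply]
         smooth_on_has_derivative[OF _ S(2)] smooth_on_fderiv[OF S(1)] Y Z)+
  note sym = fderiv_fderiv_symmetric[OF S(1) _ S(2)]
  show ?thesis
    unfolding eucl_bracket_def[of X] eucl_bracket_def[of Y "eucl_bracket Z X"]
      eucl_bracket_def[of Z "eucl_bracket X Y"] *[OF X Y] *[OF Y Z] *[OF Z X]
    unfolding eucl_bracket_def
    by (simp add: blinfun.bilinear_simps sym[OF X, of "Y x" "Z x"] sym[OF Y, of "X x" "Z x"]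
         sym[OF Z, of "X x" "Y x"])
qed


section \<open>Charts, tangent and cotangent coordinates\<close>

definition jacL :: "('m, 'e::euclidean_space) chart \<Rightarrow> ('m, 'e) chart \<Rightarrow> 'm \<Rightarrow> 'e \<Rightarrow>\<^sub>L 'e" where
  "jacL c c' p = fderiv (snd c' \<circ> chart_inv c) (snd c p)"

locale atlas =
  fixes A :: "('m::{t2_space,second_countable_topology}, 'e::euclidean_space) chart set"
  assumes atlas: "smooth_atlas A"
begin

lemma base_chart: "base_chart A p \<in> A" "p \<in> fst (base_chart A p)"
proof -
  have "\<exists>c. c \<in> A \<and> p \<in> fst c"
    using atlas unfolding smooth_atlas_def by blast
  then have "base_chart A p \<in> A \<and> p \<in> fst (base_chart A p)"
    unfolding base_chart_def by (rule someI_ex)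
  then show "base_chart A p \<in> A" "p \<in> fst (base_chart A p)" by auto
qed

lemma chart_homeo:
  "c \<in> A \<Longrightarrow> homeomorphism (fst c) (snd c ` fst c) (snd c) (chart_inv c)"
  using atlas unfolding smooth_atlas_def by blast

lemma chart_inv_left [simp]: "c \<in> A \<Longrightarrow> p \<in> fst c \<Longrightarrow> chart_inv c (snd c p) = p"
  using chart_homeo homeomorphism_apply1 by metis

lemma open_dom: "c \<in> A \<Longrightarrow> open (fst c)"
  using atlas unfolding smooth_atlas_def by blast

lemma open_cod: "c \<in> A \<Longrightarrow> open (snd c ` fst c)"
  using atlas unfolding smooth_atlas_def by blast

lemma open_chart_image:
  assumes c: "c \<in> A" and W: "open W"
  shows "open (snd c ` (fst c \<inter> W))"
proof -
  have "snd c ` (fst c \<inter> W) = chart_inv c -` W \<inter> snd c ` fst c"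
    using c by auto
  moreover have "continuous_on (snd c ` fst c) (chart_inv c)"
    using chart_homeo[OF c] by (simp add: homeomorphism_def)
  ultimately show ?thesis
    using open_cod[OF c] W continuous_on_open_vimage by metis
qed

lemma smooth_on_transition:
  "c \<in> A \<Longrightarrow> c' \<in> A \<Longrightarrow> smooth_on (snd c ` (fst c \<inter> fst c')) (snd c' \<circ> chart_inv c)"
  using atlas unfolding smooth_atlas_def by blast

lemma transition_deriv:
  assumes "c \<in> A" "c' \<in> A" "p \<in> fst c" "p \<in> fst c'"
  shows "(snd c' \<circ> chart_inv c has_derivative jacL c c' p) (at (snd c p))"
  unfolding jacL_def using assms by (intro smooth_on_has_derivative[OF smooth_on_transition]) auto

lemma jac_eq_jacL:
  "c \<in> A \<Longrightarrow> c' \<in> A \<Longrightarrow> p \<in> fst c \<Longrightarrow> p \<in> fst c' \<Longrightarrow> jac c c' p = blinfun_apply (jacL c c' p)"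
  unfolding jac_def using frechet_derivative_at[OF transition_deriv] by simp

lemma jacL_cocycle:
  assumes A: "c \<in> A" "c' \<in> A" "c'' \<in> A" and p: "p \<in> fst c" "p \<in> fst c'" "p \<in> fst c''"
  shows "jacL c' c'' p (jacL c c' p v) = jacL c c'' p v"
proof -
  have 1: "(snd c' \<circ> chart_inv c) (snd c p) = snd c' p" using A p by simp
  have "((\<lambda>x. (snd c'' \<circ> chart_inv c') ((snd c' \<circ> chart_inv c) x)) has_derivative
      (\<lambda>v. jacL c' c'' p (jacL c c' p v))) (at (snd c p))"
    by (rule has_derivative_compose[OF transition_deriv[OF A(1,2) p(1,2)]])
       (unfold 1, rule transition_deriv[OF A(2,3) p(2,3)])
  then have "fderiv (snd c'' \<circ> chart_inv c) (snd c p) v = jacL c' c'' p (jacL c c' p v)"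
    by (rule fderiv_apply_transform[OF _ open_chart_image[OF A(1) open_dom[OF A(2)]]])
       (use A p in auto)
  then show ?thesis by (simp add: jacL_def[of c c''])
qed

lemma jacL_refl [simp]: "c \<in> A \<Longrightarrow> p \<in> fst c \<Longrightarrow> jacL c c p = id_blinfun"
  unfolding jacL_def
  by (rule fderiv_transform[of "\<lambda>x. x" _ _ "snd c ` fst c"]) (auto simp: open_cod id_blinfun.rep_eq)

lemma jacL_inverse:
  "c \<in> A \<Longrightarrow> c' \<in> A \<Longrightarrow> p \<in> fst c \<Longrightarrow> p \<in> fst c' \<Longrightarrow> jacL c' c p (jacL c c' p v) = v"
  using jacL_cocycle[of c c' c p v] by simp

lemma smooth_on_jacL:
  assumes "c \<in> A" "c' \<in> A"
  shows "smooth_on (snd c ` (fst c \<inter> fst c')) (\<lambda>x. jacL c c' (chart_inv c x))"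
  by (rule smooth_on_cong[OF _ _ smooth_on_fderiv[OF _ smooth_on_transition[OF assms]]])
     (use assms in \<open>auto simp: jacL_def intro: open_chart_image open_dom\<close>)

lemma tcoord_jacL: "c \<in> A \<Longrightarrow> p \<in> fst c \<Longrightarrow> tcoord A c p v = jacL (base_chart A p) c p v"
  unfolding tcoord_def by (simp add: jac_eq_jacL base_chart)

lemma ctcoord_jacL: "c \<in> A \<Longrightarrow> p \<in> fst c \<Longrightarrow> ctcoord A c p a = a o\<^sub>L jacL c (base_chart A p) p"
  unfolding ctcoord_def
  by (rule blinfun_eqI)
     (simp add: jac_eq_jacL base_chart bounded_linear_Blinfun_apply blinfun.bounded_linear_right
       bounded_linear_compose)

lemma tcoord_change:
  "c \<in> A \<Longrightarrow> c' \<in> A \<Longrightarrow> p \<in> fst c \<Longrightarrow> p \<in> fst c' \<Longrightarrow> jacL c c' p (tcoord A c p v) = tcoord A c' p v"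
  by (simp add: tcoord_jacL jacL_cocycle base_chart)

lemma ctcoord_change:
  "c \<in> A \<Longrightarrow> c' \<in> A \<Longrightarrow> p \<in> fst c \<Longrightarrow> p \<in> fst c' \<Longrightarrow> ctcoord A c' p a o\<^sub>L jacL c c' p = ctcoord A c p a"
  by (rule blinfun_eqI) (simp add: ctcoord_jacL jacL_cocycle base_chart)

lemma ctcoord_tcoord: "c \<in> A \<Longrightarrow> p \<in> fst c \<Longrightarrow> ctcoord A c p a (tcoord A c p v) = a v"
  by (simp add: ctcoord_jacL tcoord_jacL jacL_inverse base_chart)

lemma tcoord_base [simp]: "tcoord A (base_chart A p) p v = v"
  by (simp add: tcoord_jacL base_chart)

lemma ctcoord_base [simp]: "ctcoord A (base_chart A p) p a = a"
  by (rule blinfun_eqI) (simp add: ctcoord_jacL base_chart)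

lemma linear_tcoord: "c \<in> A \<Longrightarrow> p \<in> fst c \<Longrightarrow> linear (tcoord A c p)"
  by (rule linearI) (simp_all add: tcoord_jacL blinfun.bilinear_simps)

lemma tcoord_inverse:
  assumes "c \<in> A" "p \<in> fst c"
  shows "tcoord A c p (jacL c (base_chart A p) p w) = w" "jacL c (base_chart A p) p (tcoord A c p v) = v"
  using assms by (simp_all add: tcoord_jacL jacL_inverse base_chart)

lemma bij_tcoord: "c \<in> A \<Longrightarrow> p \<in> fst c \<Longrightarrow> bij (tcoord A c p)"
  by (rule bij_betw_byWitness[of _ "jacL c (base_chart A p) p"]) (auto simp: tcoord_inverse)

lemma inv_tcoord: "c \<in> A \<Longrightarrow> p \<in> fst c \<Longrightarrow> inv (tcoord A c p) w = jacL c (base_chart A p) p w"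
  by (rule inv_f_eq) (auto simp: tcoord_inverse bij_is_inj bij_tcoord)

lemma tcoord_inv [simp]: "c \<in> A \<Longrightarrow> p \<in> fst c \<Longrightarrow> tcoord A c p (inv (tcoord A c p) w) = w"
  by (simp add: inv_tcoord tcoord_inverse)

lemma linear_ctcoord: "c \<in> A \<Longrightarrow> p \<in> fst c \<Longrightarrow> linear (ctcoord A c p)"
  by (rule linearI; rule blinfun_eqI) (simp_all add: ctcoord_jacL blinfun.bilinear_simps)

lemma ctcoord_inverse:
  assumes "c \<in> A" "p \<in> fst c"
  shows "ctcoord A c p (b o\<^sub>L jacL (base_chart A p) c p) = b"
    "ctcoord A c p a o\<^sub>L jacL (base_chart A p) c p = a"
  using assms by (auto intro!: blinfun_eqI simp: ctcoord_jacL jacL_inverse base_chart)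

lemma bij_ctcoord: "c \<in> A \<Longrightarrow> p \<in> fst c \<Longrightarrow> bij (ctcoord A c p)"
  by (rule bij_betw_byWitness[of _ "\<lambda>b. b o\<^sub>L jacL (base_chart A p) c p"]) (auto simp: ctcoord_inverse)

lemma ctcoord_inv [simp]: "c \<in> A \<Longrightarrow> p \<in> fst c \<Longrightarrow> ctcoord A c p (inv (ctcoord A c p) w) = w"
  using bij_ctcoord by (metis bij_inv_eq_iff)

text \<open>Smooth transition maps make it enough to test smoothness in one chart whose domain contains
  the set.\<close>

lemma smooth_map_on_chart:
  assumes c: "c \<in> A" and W: "open W" "W \<subseteq> fst c"
  shows "smooth_map_on A W f \<longleftrightarrow> smooth_on (snd c ` W) (f \<circ> chart_inv c)"
proof
  assume "smooth_map_on A W f"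
  then show "smooth_on (snd c ` W) (f \<circ> chart_inv c)"
    using c W(2) unfolding smooth_map_on_def by (metis inf.absorb_iff2)
next
  assume f: "smooth_on (snd c ` W) (f \<circ> chart_inv c)"
  have opn: "open (snd d ` (fst d \<inter> W))" if "d \<in> A" for d
    using open_chart_image[OF that W(1)] .
  have "smooth_on (snd d ` (fst d \<inter> W)) (f \<circ> chart_inv d)" if d: "d \<in> A" for d
  proof (rule smooth_on_cong[OF opn[OF d]])
    show "smooth_on (snd d ` (fst d \<inter> W)) (\<lambda>x. (f \<circ> chart_inv c) ((snd c \<circ> chart_inv d) x))"
    proof (rule smooth_on_compose[OF opn[OF d] _ _ _ f])
      show "open (snd c ` W)" using opn[OF c] W(2) by (simp add: Int_absorb1)
      show "(snd c \<circ> chart_inv d) ` snd d ` (fst d \<inter> W) \<subseteq> snd c ` W"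
        using d by auto
      show "smooth_on (snd d ` (fst d \<inter> W)) (snd c \<circ> chart_inv d)"
        using W(2) by (intro smooth_on_mono[OF smooth_on_transition[OF d c]]) auto
    qed
  qed (use d c W(2) in auto)
  then show "smooth_map_on A W f" unfolding smooth_map_on_def by blast
qed

lemma smooth_section_tangent_iff:
  "smooth_section A (tangent_bundle A) X \<longleftrightarrow> (\<forall>c\<in>A. smooth_on (snd c ` fst c) (vfield_rep A c X))"
proof -
  have "smooth_map_on A (fst c) (\<lambda>p. tcoord A c p (X p)) \<longleftrightarrow> smooth_on (snd c ` fst c) (vfield_rep A c X)"
    if "c \<in> A" for c
    using smooth_map_on_chart[OF that open_dom[OF that] order_refl] by (simp add: vfield_rep_def[abs_def] comp_def)
  then show ?thesis
    unfolding smooth_section_def tangent_bundle_def by simp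
qed

lemma smooth_section_cotangent_iff:
  "smooth_section A (cotangent_bundle A) \<alpha> \<longleftrightarrow> (\<forall>c\<in>A. smooth_on (snd c ` fst c) (oneform_rep A c \<alpha>))"
proof -
  have "smooth_map_on A (fst c) (\<lambda>p. ctcoord A c p (\<alpha> p)) \<longleftrightarrow> smooth_on (snd c ` fst c) (oneform_rep A c \<alpha>)"
    if "c \<in> A" for c
    using smooth_map_on_chart[OF that open_dom[OF that] order_refl] by (simp add: oneform_rep_def[abs_def] comp_def)
  then show ?thesis
    unfolding smooth_section_def cotangent_bundle_def by simp
qed

lemma vfield_rep_at [simp]: "c \<in> A \<Longrightarrow> p \<in> fst c \<Longrightarrow> vfield_rep A c X (snd c p) = tcoord A c p (X p)"
  by (simp add: vfield_rep_def)

lemma oneform_rep_at [simp]: "c \<in> A \<Longrightarrow> p \<in> fst c \<Longrightarrow> oneform_rep A c \<alpha> (snd c p) = ctcoord A c p (\<alpha> p)"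
  by (simp add: oneform_rep_def)

lemma vfield_rep_change:
  assumes "c \<in> A" "c' \<in> A" "x \<in> snd c ` (fst c \<inter> fst c')"
  shows "vfield_rep A c' X ((snd c' \<circ> chart_inv c) x) = fderiv (snd c' \<circ> chart_inv c) x (vfield_rep A c X x)"
  using assms by (auto simp: jacL_def[symmetric] tcoord_change)

lemma oneform_rep_change:
  assumes "c \<in> A" "c' \<in> A" "x \<in> snd c ` (fst c \<inter> fst c')"
  shows "oneform_rep A c \<alpha> x = oneform_rep A c' \<alpha> ((snd c' \<circ> chart_inv c) x) o\<^sub>L fderiv (snd c' \<circ> chart_inv c) x"
  using assms by (auto simp: jacL_def[symmetric] ctcoord_change)

text \<open>The definition evaluates the exterior derivative at \<open>p\<close> in the base chart of \<open>p\<close>; comparing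
  that chart with a fixed one makes the result accessible to differentiation in \<open>p\<close>.\<close>

lemma ext_deriv_chart:
  assumes \<alpha>: "smooth_section A (cotangent_bundle A) \<alpha>" and c: "c \<in> A" "p \<in> fst c"
  shows "ext_deriv A \<alpha> p u v =
    eucl_ext_deriv (oneform_rep A c \<alpha>) (snd c p) (tcoord A c p u) (tcoord A c p v)"
proof -
  let ?b = "base_chart A p"
  let ?\<tau> = "snd c \<circ> chart_inv ?b" and ?S = "snd ?b ` (fst ?b \<inter> fst c)"
  have sm: "smooth_on (snd c ` fst c) (oneform_rep A c \<alpha>)" if "c \<in> A" for c
    using \<alpha> that smooth_section_cotangent_iff by blast
  have "ext_deriv A \<alpha> p u v = eucl_ext_deriv (oneform_rep A ?b \<alpha>) (snd ?b p) u v"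
    unfolding ext_deriv_def Let_def eucl_ext_deriv_def
    by (simp add: smooth_on_frechet_derivative[OF sm[OF base_chart(1)]] base_chart)
  also have "\<dots> = eucl_ext_deriv (oneform_rep A c \<alpha>) (?\<tau> (snd ?b p)) (fderiv ?\<tau> (snd ?b p) u) (fderiv ?\<tau> (snd ?b p) v)"
    using c base_chart[of p]
    by (intro eucl_ext_deriv_pullback[where S = ?S and T = "snd c ` fst c"] sm smooth_on_transition
        open_chart_image open_dom oneform_rep_change) auto
  finally show ?thesis
    using c by (simp add: jacL_def[symmetric] tcoord_jacL base_chart)
qed

lemma lie_bracket_chart:
  assumes X: "smooth_section A (tangent_bundle A) X" and Y: "smooth_section A (tangent_bundle A) Y"
    and c: "c \<in> A" "p \<in> fst c"
  shows "tcoord A c p (lie_bracket A X Y p) =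
    eucl_bracket (vfield_rep A c X) (vfield_rep A c Y) (snd c p)"
proof -
  let ?b = "base_chart A p"
  let ?\<tau> = "snd c \<circ> chart_inv ?b" and ?S = "snd ?b ` (fst ?b \<inter> fst c)"
  have sm: "smooth_on (snd c ` fst c) (vfield_rep A c X)" "smooth_on (snd c ` fst c) (vfield_rep A c Y)"
    if "c \<in> A" for c
    using X Y that smooth_section_tangent_iff by blast+
  have "lie_bracket A X Y p = eucl_bracket (vfield_rep A ?b X) (vfield_rep A ?b Y) (snd ?b p)"
    unfolding lie_bracket_def Let_def eucl_bracket_def
    by (simp add: smooth_on_frechet_derivative[OF sm(1)[OF base_chart(1)]] smooth_on_frechet_derivative[OF sm(2)[OF base_chart(1)]] base_chart)
  then have "tcoord A c p (lie_bracket A X Y p) =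
      fderiv ?\<tau> (snd ?b p) (eucl_bracket (vfield_rep A ?b X) (vfield_rep A ?b Y) (snd ?b p))"
    using c by (simp add: tcoord_jacL jacL_def)
  also have "\<dots> = eucl_bracket (vfield_rep A c X) (vfield_rep A c Y) (?\<tau> (snd ?b p))"
    using c base_chart[of p]
    by (intro eucl_bracket_pushforward[symmetric, where S = ?S and T = "snd c ` fst c"] sm smooth_on_transition
        open_chart_image open_dom vfield_rep_change) (auto intro: smooth_on_mono[OF sm(1)] smooth_on_mono[OF sm(2)])
  finally show ?thesis by (simp add: base_chart)
qed

end


section \<open>Alternating forms of top degree\<close>

definition multilinear_form :: "nat \<Rightarrow> ((nat \<Rightarrow> 'e::real_vector) \<Rightarrow> real) \<Rightarrow> bool" where
  "multilinear_form k \<omega> \<longleftrightarrow> (\<forall>i<k. \<forall>v. linear (\<lambda>x. \<omega> (v(i := x)))) \<and>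
     (\<forall>v v'. (\<forall>i<k. v i = v' i) \<longrightarrow> \<omega> v = \<omega> v')"

lemma multilinear_form_linear:
  "multilinear_form k \<omega> \<Longrightarrow> i < k \<Longrightarrow> linear (\<lambda>x. \<omega> (v(i := x)))"
  by (simp add: multilinear_form_def)

lemma multilinear_form_cong:
  assumes "multilinear_form k \<omega>" "\<And>i. i < k \<Longrightarrow> v i = v' i"
  shows "\<omega> v = \<omega> v'"
  using assms(1)[unfolded multilinear_form_def, THEN conjunct2, rule_format, of v v'] assms(2) by simp

lemma multilinear_form_wedge:
  assumes \<omega>: "multilinear_form k \<omega>" and \<tau>: "multilinear_form l \<tau>"
  shows "multilinear_form (k + l) (wedge k l \<omega> \<tau>)"
  unfolding multilinear_form_def
proof (intro conjI allI impI)
  fix i v assume i: "i < k + l"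
  let ?t = "\<lambda>\<sigma> x. of_int (sign \<sigma>) * \<omega> (\<lambda>m. (v(i := x)) (\<sigma> m)) * \<tau> (\<lambda>m. (v(i := x)) (\<sigma> (k + m)))"
  have "linear (?t \<sigma>)" if \<sigma>: "\<sigma> permutes {..<k + l}" for \<sigma>
  proof -
    obtain j where j: "j < k + l" "\<sigma> j = i"
      using \<sigma> i by (metis lessThan_iff permutes_image imageE)
    have eq: "\<sigma> m = i \<longleftrightarrow> m = j" for m
      using j \<sigma> by (metis permutes_inverses(2))
    show ?thesis
    proof (cases "j < k")
      case True
      have 1: "(\<lambda>m. (v(i := x)) (\<sigma> m)) = (\<lambda>m. v (\<sigma> m))(j := x)" for x
        by (auto simp: eq)
      have 2: "(\<lambda>m. (v(i := x)) (\<sigma> (k + m))) = (\<lambda>m. v (\<sigma> (k + m)))" for x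
        using True by (auto simp: eq)
      have lin: "linear (\<lambda>x. \<omega> ((\<lambda>m. v (\<sigma> m))(j := x)))"
        using \<omega> True by (rule multilinear_form_linear)
      show ?thesis
        unfolding 1 2
        by (rule linearI) (simp_all add: linear_add[OF lin] linear_scale[OF lin] distrib_left distrib_right mult_ac)
    next
      case False
      define j' where "j' = j - k"
      have j': "j' < l" "j = k + j'" using False j(1) by (auto simp: j'_def)
      have 1: "\<omega> (\<lambda>m. (v(i := x)) (\<sigma> m)) = \<omega> (\<lambda>m. v (\<sigma> m))" for x
        by (rule multilinear_form_cong[OF \<omega>]) (use False in \<open>auto simp: eq\<close>)
      have 2: "(\<lambda>m. (v(i := x)) (\<sigma> (k + m))) = (\<lambda>m. v (\<sigma> (k + m)))(j' := x)" for x
        by (auto simp: eq j')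
      have lin: "linear (\<lambda>x. \<tau> ((\<lambda>m. v (\<sigma> (k + m)))(j' := x)))"
        using \<tau> j'(1) by (rule multilinear_form_linear)
      show ?thesis
        unfolding 1 2
        by (rule linearI) (simp_all add: linear_add[OF lin] linear_scale[OF lin] distrib_left distrib_right mult_ac)
    qed
  qed
  then have lin: "linear (\<lambda>x. \<Sum>\<sigma> | \<sigma> permutes {..<k + l}. ?t \<sigma> x)"
    by (intro linear_compose_sum) auto
  show "linear (\<lambda>x. wedge k l \<omega> \<tau> (v(i := x)))"
    unfolding wedge_def
    by (rule linearI) (simp_all only: linear_add[OF lin] linear_scale[OF lin] add_divide_distrib
        real_scaleR_def times_divide_eq_right)
next
  fix v v' :: "nat \<Rightarrow> 'a" assume v: "\<forall>i<k + l. v i = v' i"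
  have "\<omega> (\<lambda>i. v (\<sigma> i)) = \<omega> (\<lambda>i. v' (\<sigma> i))" "\<tau> (\<lambda>i. v (\<sigma> (k + i))) = \<tau> (\<lambda>i. v' (\<sigma> (k + i)))"
    if \<sigma>: "\<sigma> permutes {..<k + l}" for \<sigma>
  proof -
    have "\<sigma> i < k + l" if "i < k + l" for i
      using permutes_in_image[OF \<sigma>] that by auto
    then show "\<omega> (\<lambda>i. v (\<sigma> i)) = \<omega> (\<lambda>i. v' (\<sigma> i))" "\<tau> (\<lambda>i. v (\<sigma> (k + i))) = \<tau> (\<lambda>i. v' (\<sigma> (k + i)))"
      by (auto intro!: multilinear_form_cong[OF \<omega>] multilinear_form_cong[OF \<tau>] v[rule_format])
  qed
  then show "wedge k l \<omega> \<tau> v = wedge k l \<omega> \<tau> v'"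
    unfolding wedge_def by (intro arg_cong2[of _ _ _ _ "(/)"] sum.cong) auto
qed

lemma multilinear_form_wedge_power:
  "multilinear_form k \<omega> \<Longrightarrow> multilinear_form (k * j) (wedge_power k \<omega> j)"
  by (induction j) (auto simp: multilinear_form_wedge, simp add: multilinear_form_def)

text \<open>Reindexing the sum over permutations by the transposition of \<open>i\<close> and \<open>j\<close> changes its sign
  and fixes \<open>v\<close>.\<close>

lemma wedge_repeated_eq_0:
  assumes "i < k + l" "j < k + l" "i \<noteq> j" "v i = v j"
  shows "wedge k l \<omega> \<tau> v = 0"
proof -
  let ?S = "{\<sigma>. \<sigma> permutes {..<k + l}}" and ?\<rho> = "Transposition.transpose i j"
  let ?f = "\<lambda>\<sigma>. of_int (sign \<sigma>) * \<omega> (\<lambda>m. v (\<sigma> m)) * \<tau> (\<lambda>m. v (\<sigma> (k + m)))"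
  have \<rho>: "?\<rho> permutes {..<k + l}" using assms by (intro permutes_swap_id) auto
  have v: "v (?\<rho> m) = v m" for m using assms by (auto simp: Transposition.transpose_def)
  have "sum ?f ?S = (\<Sum>\<sigma>\<in>?S. ?f (?\<rho> \<circ> \<sigma>))"
    by (rule setum_permutations_compose_left[OF \<rho>])
  also have "\<dots> = (\<Sum>\<sigma>\<in>?S. - ?f \<sigma>)"
  proof (rule sum.cong[OF refl])
    fix \<sigma> assume "\<sigma> \<in> ?S"
    then have "permutation \<sigma>" by (auto simp: permutation_permutes)
    then have "sign (?\<rho> \<circ> \<sigma>) = - sign \<sigma>"
      using assms(3) by (simp add: sign_compose permutation_swap_id sign_swap_id)
    then show "?f (?\<rho> \<circ> \<sigma>) = - ?f \<sigma>" by (simp add: v)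
  qed
  finally have "sum ?f ?S = 0" by (simp add: sum_negf)
  then show ?thesis unfolding wedge_def by simp
qed

lemma wedge_invariant:
  assumes "\<And>v. \<omega> (\<lambda>i. P (v i)) = \<omega> v" "\<And>v. \<tau> (\<lambda>i. P (v i)) = \<tau> v"
  shows "wedge k l \<omega> \<tau> (\<lambda>i. P (v i)) = wedge k l \<omega> \<tau> v"
  unfolding wedge_def using assms(1)[of "\<lambda>i. v (_ i)"] assms(2)[of "\<lambda>i. v (_ (k + i))"] by simp

lemma wedge_power_invariant:
  assumes "\<And>v. \<omega> (\<lambda>i. P (v i)) = \<omega> v"
  shows "wedge_power k \<omega> j (\<lambda>i. P (v i)) = wedge_power k \<omega> j v"
proof (induction j arbitrary: v)
  case (Suc j)
  show ?case
    unfolding wedge_power.simps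
    by (rule wedge_invariant[where P = P and \<omega> = \<omega>]) (rule assms, rule Suc)
qed simp

text \<open>The arguments are linearly dependent: one of them is repeated, or lies in the span of the
  others, where the form vanishes by linearity.\<close>

lemma alternating_form_on_small_subspace:
  fixes \<Omega> :: "(nat \<Rightarrow> 'e::euclidean_space) \<Rightarrow> real"
  assumes \<Omega>: "multilinear_form N \<Omega>"
    and alt: "\<And>v i j. i < N \<Longrightarrow> j < N \<Longrightarrow> i \<noteq> j \<Longrightarrow> v i = v j \<Longrightarrow> \<Omega> v = 0"
    and v: "\<And>i. i < N \<Longrightarrow> v i \<in> U" and U: "dim U < N"
  shows "\<Omega> v = 0"
proof (cases "inj_on v {..<N}")
  case False
  then show ?thesis using alt unfolding inj_on_def by (metis lessThan_iff)
next
  case True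
  have "dependent (v ` {..<N})"
  proof (rule ccontr)
    assume "independent (v ` {..<N})"
    then have "card (v ` {..<N}) \<le> dim U"
      by (intro independent_card_le_dim) (use v in auto)
    then show False using U card_image[OF True] by simp
  qed
  then obtain j where j: "j < N" "v j \<in> span (v ` {..<N} - {v j})"
    unfolding dependent_def by auto
  have sub: "v ` {..<N} - {v j} \<subseteq> v ` ({..<N} - {j})" by auto
  have "\<Omega> (v(j := v j)) = 0"
  proof (rule linear_eq_0_on_span[of "\<lambda>x. \<Omega> (v(j := x))"])
    show "linear (\<lambda>x. \<Omega> (v(j := x)))" using \<Omega> j(1) by (rule multilinear_form_linear)
    show "v j \<in> span (v ` ({..<N} - {j}))" using j(2) span_mono[OF sub] by blast
    fix x assume "x \<in> v ` ({..<N} - {j})"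
    then obtain i where "i < N" "i \<noteq> j" "x = v i" by auto
    then show "\<Omega> (v(j := x)) = 0" using alt[of i j "v(j := x)"] j(1) by simp
  qed
  then show ?thesis by simp
qed

text \<open>The form does not change under the orthogonal projection along a vector \<open>u\<close> in both kernels;
  if \<open>u \<noteq> 0\<close>, the range of that projection is a hyperplane, on which a top-degree form vanishes.\<close>

lemma wedge_top_nonzero_imp_kernel_trivial:
  fixes \<theta> :: "'e::euclidean_space \<Rightarrow> real" and \<omega> :: "'e \<Rightarrow> 'e \<Rightarrow> real"
  assumes dim: "DIM('e) = 1 + 2 * n"
    and \<theta>: "linear \<theta>" and \<omega>: "\<And>u. linear (\<omega> u)" "\<And>v. linear (\<lambda>u. \<omega> u v)"
    and nz: "wedge 1 (2 * n) (\<lambda>v. \<theta> (v 0)) (wedge_power 2 (\<lambda>v. \<omega> (v 0) (v 1)) n) w \<noteq> 0"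
    and u: "\<theta> u = 0" "\<And>v. \<omega> u v = 0" "\<And>v. \<omega> v u = 0"
  shows "u = 0"
proof (rule ccontr)
  assume u0: "u \<noteq> 0"
  define P where "P v = v - ((u \<bullet> v) / (u \<bullet> u)) *\<^sub>R u" for v
  have P\<theta>: "\<theta> (P v) = \<theta> v" for v
    using u by (simp add: P_def linear_diff[OF \<theta>] linear_scale[OF \<theta>])
  have P\<omega>: "\<omega> (P v) (P v') = \<omega> v v'" for v v'
    using u by (simp add: P_def linear_diff[OF \<omega>(1)] linear_scale[OF \<omega>(1)]
        linear_diff[OF \<omega>(2)] linear_scale[OF \<omega>(2)])
  let ?\<Omega> = "wedge 1 (2 * n) (\<lambda>v. \<theta> (v 0)) (wedge_power 2 (\<lambda>v. \<omega> (v 0) (v 1)) n)"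
  have m\<theta>: "multilinear_form 1 (\<lambda>v. \<theta> (v 0))"
    using \<theta> by (auto simp: multilinear_form_def)
  have "multilinear_form 2 (\<lambda>v. \<omega> (v 0) (v 1))"
    using \<omega> by (auto simp: multilinear_form_def less_2_cases_iff)
  then have m: "multilinear_form (1 + 2 * n) ?\<Omega>"
    by (intro multilinear_form_wedge m\<theta> multilinear_form_wedge_power)
  have "?\<Omega> (\<lambda>i. P (w i)) = 0"
  proof (rule alternating_form_on_small_subspace[OF m, where U = "{v. u \<bullet> v = 0}"])
    show "?\<Omega> v = 0" if "i < 1 + 2 * n" "j < 1 + 2 * n" "i \<noteq> j" "v i = v j" for v i j
      by (rule wedge_repeated_eq_0[OF that])
    show "P (w i) \<in> {v. u \<bullet> v = 0}" for i
      using u0 by (simp add: P_def inner_diff_right)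
    show "dim {v. u \<bullet> v = 0} < 1 + 2 * n"
      using dim_hyperplane[OF u0] dim by simp
  qed
  moreover have "?\<Omega> (\<lambda>i. P (w i)) = ?\<Omega> w"
  proof (rule wedge_invariant[where P = P])
    show "wedge_power 2 (\<lambda>v. \<omega> (v 0) (v 1)) n (\<lambda>i. P (v i)) = wedge_power 2 (\<lambda>v. \<omega> (v 0) (v 1)) n v" for v
      by (rule wedge_power_invariant[where P = P]) (rule P\<omega>)
  qed (rule P\<theta>)
  ultimately show False using nz by simp
qed

section \<open>Alternating bilinear forms in odd dimension\<close>

text \<open>A pair \<open>u\<close>, \<open>v\<close> with \<open>\<omega> u v = 1\<close> splits off a plane: the common kernel of \<open>\<omega> u\<close> and \<open>\<omega> v\<close> is a
  complement on which \<open>\<omega>\<close> is still nondegenerate.\<close>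

lemma nondegenerate_alternating_imp_even_dim:
  fixes \<omega> :: "'e::euclidean_space \<Rightarrow> 'e \<Rightarrow> real"
  assumes lin: "\<And>u. linear (\<omega> u)" and anti: "\<And>u v. \<omega> v u = - \<omega> u v"
    and V: "subspace V" and nd: "\<And>u. u \<in> V \<Longrightarrow> (\<And>v. v \<in> V \<Longrightarrow> \<omega> u v = 0) \<Longrightarrow> u = 0"
  shows "even (dim V)"
  using V nd
proof (induction "dim V" arbitrary: V rule: less_induct)
  case less
  note V = \<open>subspace V\<close>
  have alt: "\<omega> u u = 0" for u using anti[of u u] by simp
  have lin2: "linear (\<lambda>u. \<omega> u v)" for v
    using linear_compose_neg[OF lin[of v]] anti[of v] by simp
  note L = linear_add[OF lin] linear_diff[OF lin] linear_scale[OF lin] linear_0[OF lin]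
    linear_add[OF lin2] linear_diff[OF lin2] linear_scale[OF lin2] linear_0[OF lin2]
  show ?case
  proof (cases "dim V = 0")
    case False
    then obtain u where u: "u \<in> V" "u \<noteq> 0" by (auto simp: dim_eq_0)
    then obtain v0 where v0: "v0 \<in> V" "\<omega> u v0 \<noteq> 0" using less.prems(2) by blast
    define v where "v = (1 / \<omega> u v0) *\<^sub>R v0"
    have v: "v \<in> V" "\<omega> u v = 1" "\<omega> v u = - 1"
      using v0 V anti[of v u] by (auto simp: v_def subspace_scale L)
    define W where "W = {x \<in> V. \<omega> u x = 0 \<and> \<omega> v x = 0}"
    have W: "subspace W"
      using V unfolding W_def subspace_def by (auto simp: L)
    \<comment> \<open>The projection of \<open>V\<close> onto \<open>W\<close> along the span of \<open>u\<close> and \<open>v\<close>.\<close>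
    have proj: "y + \<omega> v y *\<^sub>R u - \<omega> u y *\<^sub>R v \<in> W" if "y \<in> V" for y
      using that u v V by (auto simp: W_def L alt intro!: subspace_add subspace_diff subspace_scale)
    have "u \<notin> span (insert v W)"
    proof
      assume "u \<in> span (insert v W)"
      then obtain k where "u - k *\<^sub>R v \<in> span W" by (auto simp: span_breakdown_eq)
      then have "\<omega> v (u - k *\<^sub>R v) = 0" using W by (simp add: span_eq_iff[THEN iffD2] W_def)
      then show False using v alt by (simp add: L)
    qed
    moreover have "v \<notin> span W"
      using W v by (simp add: span_eq_iff[THEN iffD2] W_def)
    ultimately have d: "dim (insert u (insert v W)) = dim W + 2"
      by (simp add: dim_insert)
    have "V \<subseteq> span (insert u (insert v W))"
    proof
      fix y assume "y \<in> V"
      then have "(y + \<omega> v y *\<^sub>R u - \<omega> u y *\<^sub>R v) - \<omega> v y *\<^sub>R u + \<omega> u y *\<^sub>R v \<in> span (insert u (insert v W))"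
        by (intro span_add span_diff span_scale span_base) (auto simp: proj)
      then show "y \<in> span (insert u (insert v W))" by simp
    qed
    moreover have "insert u (insert v W) \<subseteq> V" using u v by (auto simp: W_def)
    ultimately have "dim V = dim (insert u (insert v W))"
      by (metis V dim_span span_minimal subset_antisym)
    with d have dV: "dim V = dim W + 2" by simp
    have "even (dim W)"
    proof (rule less.hyps)
      fix x assume x: "x \<in> W" and x0: "\<And>y. y \<in> W \<Longrightarrow> \<omega> x y = 0"
      have "\<omega> x y = 0" if "y \<in> V" for y
        using x0[OF proj[OF that]] x anti[of x u] anti[of x v] by (simp add: L W_def)
      then show "x = 0" using less.prems(2) x by (auto simp: W_def)
    qed (use dV W in auto)
    then show ?thesis using dV by simp
  next
    case True
    then show ?thesis by presburger
  qed
qed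

lemma alternating_odd_dim_kernel:
  fixes \<omega> :: "'e::euclidean_space \<Rightarrow> 'e \<Rightarrow> real"
  assumes "\<And>u. linear (\<omega> u)" "\<And>u v. \<omega> v u = - \<omega> u v" "odd DIM('e)"
  shows "\<exists>u. u \<noteq> 0 \<and> (\<forall>v. \<omega> u v = 0)"
proof (rule ccontr)
  assume *: "\<not> ?thesis"
  have "even (dim (UNIV :: 'e set))"
    by (rule nondegenerate_alternating_imp_even_dim[OF assms(1,2) subspace_UNIV]) (use * in blast)+
  then show False using assms(3) by simp
qed


section \<open>The tangent algebroid and transport of algebroid structures\<close>

context atlas begin

lemma smooth_map_onI:
  assumes "c \<in> A" "open W" "W \<subseteq> fst c" "smooth_on (snd c ` W) g" "\<And>p. p \<in> W \<Longrightarrow> f p = g (snd c p)"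
  shows "smooth_map_on A W f"
proof -
  have "open (snd c ` W)"
    using open_chart_image[OF assms(1,2)] assms(3) by (simp add: Int_absorb1)
  then have "smooth_on (snd c ` W) (f \<circ> chart_inv c)"
    by (rule smooth_on_cong[OF _ _ assms(4)]) (use assms in auto)
  then show ?thesis by (rule smooth_map_on_chart[OF assms(1-3), THEN iffD2])
qed

lemma open_overlap: "c \<in> A \<Longrightarrow> c' \<in> A \<Longrightarrow> open (fst c \<inter> fst c')"
  by (simp add: open_dom open_Int)

lemma open_overlap_image: "c \<in> A \<Longrightarrow> c' \<in> A \<Longrightarrow> open (snd c ` (fst c \<inter> fst c'))"
  by (simp add: open_dom open_chart_image)

lemma smooth_tangent_transition:
  assumes "c \<in> A" "c' \<in> A"
  shows "smooth_map_on A (fst c \<inter> fst c') (\<lambda>p. tcoord A c' p (inv (tcoord A c p) w))"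
proof (rule smooth_map_onI[OF assms(1) open_overlap[OF assms]])
  show "smooth_on (snd c ` (fst c \<inter> fst c')) (\<lambda>x. jacL c c' (chart_inv c x) w)"
    by (intro smooth_on_blinfun_apply smooth_on_jacL smooth_on_const open_overlap_image assms)
  fix p assume "p \<in> fst c \<inter> fst c'"
  then show "tcoord A c' p (inv (tcoord A c p) w) = jacL c c' (chart_inv c (snd c p)) w"
    using assms tcoord_change[of c c' p "inv (tcoord A c p) w"] by simp
qed auto

text \<open>A covector is transformed by the Jacobian from the new chart to the old one, which is a smooth
  function of the new coordinates.\<close>

lemma smooth_cotangent_transition:
  assumes "c \<in> A" "c' \<in> A"
  shows "smooth_map_on A (fst c \<inter> fst c') (\<lambda>p. ctcoord A c' p (inv (ctcoord A c p) w))"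
proof (rule smooth_map_onI[OF assms(2) open_overlap[OF assms]])
  show "smooth_on (snd c' ` (fst c \<inter> fst c')) (\<lambda>x. w o\<^sub>L jacL c' c (chart_inv c' x))"
    using smooth_on_jacL[OF assms(2,1)] open_overlap_image[OF assms(2,1)]
    by (subst Int_commute, intro smooth_on_blinfun_compose smooth_on_const)
  fix p assume "p \<in> fst c \<inter> fst c'"
  then show "ctcoord A c' p (inv (ctcoord A c p) w) = w o\<^sub>L jacL c' c (chart_inv c' (snd c' p))"
    using assms ctcoord_change[of c' c p "inv (ctcoord A c p) w"] by simp
qed auto

lemma UN_dom: "(\<Union>c\<in>A. fst c) = UNIV"
  using atlas unfolding smooth_atlas_def by blast

lemma vector_bundle_tangent: "vector_bundle A (tangent_bundle A)"
proof -
  have "\<exists>S::'e set. finite S \<and> span S = UNIV"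
    using span_Basis finite_Basis by blast
  then show ?thesis
    unfolding vector_bundle_def tangent_bundle_def
    using UN_dom by (auto simp: open_dom linear_tcoord bij_tcoord intro: smooth_tangent_transition)
qed

lemma vector_bundle_cotangent: "vector_bundle A (cotangent_bundle A)"
proof -
  have "a \<in> span (blinfun_inner_right ` Basis)" for a :: "'e \<Rightarrow>\<^sub>L real"
  proof -
    have "a = (\<Sum>b\<in>Basis. a b *\<^sub>R blinfun_inner_right b)"
      by (simp only: dual_basis_expansion)
    also have "\<dots> \<in> span (blinfun_inner_right ` Basis)"
      by (intro span_sum span_scale span_base) auto
    finally show ?thesis .
  qed
  then have "\<exists>S::('e \<Rightarrow>\<^sub>L real) set. finite S \<and> span S = UNIV"
    by (intro exI[of _ "blinfun_inner_right ` Basis"]) auto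
  then show ?thesis
    unfolding vector_bundle_def cotangent_bundle_def
    using UN_dom by (auto simp: open_dom linear_ctcoord bij_ctcoord intro: smooth_cotangent_transition)
qed

lemma smooth_section_eq:
  "smooth_section A E s \<longleftrightarrow> (\<forall>U \<Phi>. (U, \<Phi>) \<in> E \<longrightarrow> (\<forall>c\<in>A.
     smooth_on (snd c ` (fst c \<inter> U)) (\<lambda>x. \<Phi> (chart_inv c x) (s (chart_inv c x)))))"
  unfolding smooth_section_def smooth_map_on_def comp_def by blast

lemma smooth_section_lincomb:
  assumes E: "vector_bundle A E" and s: "smooth_section A E s" "smooth_section A E t"
  shows "smooth_section A E (\<lambda>q. a *\<^sub>R s q + b *\<^sub>R t q)"
  unfolding smooth_section_eq
proof (intro allI impI ballI)
  fix U \<Phi> c assume U: "(U, \<Phi>) \<in> E" and c: "c \<in> A"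
  have E': "open U" "\<And>p. p \<in> U \<Longrightarrow> linear (\<Phi> p)"
    using E U unfolding vector_bundle_def by auto
  have opn: "open (snd c ` (fst c \<inter> U))" by (rule open_chart_image[OF c E'(1)])
  have "smooth_on (snd c ` (fst c \<inter> U)) (\<lambda>x. a *\<^sub>R \<Phi> (chart_inv c x) (s (chart_inv c x))
      + b *\<^sub>R \<Phi> (chart_inv c x) (t (chart_inv c x)))"
    using s U c unfolding smooth_section_eq
    by (intro smooth_on_add smooth_on_scaleR smooth_on_const opn) auto
  then show "smooth_on (snd c ` (fst c \<inter> U))
      (\<lambda>x. \<Phi> (chart_inv c x) (a *\<^sub>R s (chart_inv c x) + b *\<^sub>R t (chart_inv c x)))"
    by (rule smooth_on_cong[OF opn, rotated])
       (use c E'(2) in \<open>auto simp: linear_add linear_scale\<close>)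
qed

lemma smooth_section_scale:
  assumes E: "vector_bundle A E" and s: "smooth_section A E s" and \<phi>: "smooth_map_on A UNIV \<phi>"
  shows "smooth_section A E (\<lambda>q. \<phi> q *\<^sub>R s q)"
  unfolding smooth_section_eq
proof (intro allI impI ballI)
  fix U \<Phi> c assume U: "(U, \<Phi>) \<in> E" and c: "c \<in> A"
  have E': "open U" "\<And>p. p \<in> U \<Longrightarrow> linear (\<Phi> p)"
    using E U unfolding vector_bundle_def by auto
  have opn: "open (snd c ` (fst c \<inter> U))" by (rule open_chart_image[OF c E'(1)])
  have "smooth_on (snd c ` (fst c \<inter> U)) (\<lambda>x. \<phi> (chart_inv c x))"
    using \<phi> c unfolding smooth_map_on_def by (auto simp: comp_def intro: smooth_on_mono)
  then have "smooth_on (snd c ` (fst c \<inter> U)) (\<lambda>x. \<phi> (chart_inv c x) *\<^sub>R \<Phi> (chart_inv c x) (s (chart_inv c x)))"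
    using s U c unfolding smooth_section_eq by (intro smooth_on_scaleR opn) auto
  then show "smooth_on (snd c ` (fst c \<inter> U)) (\<lambda>x. \<Phi> (chart_inv c x) (\<phi> (chart_inv c x) *\<^sub>R s (chart_inv c x)))"
    by (rule smooth_on_cong[OF opn, rotated]) (use c E'(2) in \<open>auto simp: linear_scale\<close>)
qed

lemma base_cod: "snd (base_chart A p) p \<in> snd (base_chart A p) ` fst (base_chart A p)"
  using base_chart by blast

lemma vfield_rep_derivative:
  assumes "smooth_section A (tangent_bundle A) X"
  shows "(vfield_rep A (base_chart A p) X has_derivative
    fderiv (vfield_rep A (base_chart A p) X) (snd (base_chart A p) p)) (at (snd (base_chart A p) p))"
  using assms smooth_section_tangent_iff base_chart by (intro smooth_on_has_derivative[OF _ base_cod]) blast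

lemma lie_bracket_eq:
  assumes "(vfield_rep A (base_chart A p) X has_derivative X') (at (snd (base_chart A p) p))"
    and "(vfield_rep A (base_chart A p) Y has_derivative Y') (at (snd (base_chart A p) p))"
  shows "lie_bracket A X Y p = Y' (X p) - X' (Y p)"
  unfolding lie_bracket_def Let_def frechet_derivative_at[OF assms(1), symmetric]
    frechet_derivative_at[OF assms(2), symmetric] ..

lemma lie_bracket_lincomb:
  assumes s: "smooth_section A (tangent_bundle A) s" "smooth_section A (tangent_bundle A) s'"
    and t: "smooth_section A (tangent_bundle A) t"
  shows "lie_bracket A (\<lambda>q. a *\<^sub>R s q + b *\<^sub>R s' q) t p
    = a *\<^sub>R lie_bracket A s t p + b *\<^sub>R lie_bracket A s' t p"
proof -
  let ?c = "base_chart A p"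
  note d = vfield_rep_derivative
  have "((\<lambda>x. a *\<^sub>R vfield_rep A ?c s x + b *\<^sub>R vfield_rep A ?c s' x) has_derivative
      (\<lambda>v. a *\<^sub>R fderiv (vfield_rep A ?c s) (snd ?c p) v + b *\<^sub>R fderiv (vfield_rep A ?c s') (snd ?c p) v))
      (at (snd ?c p))"
    by (intro has_derivative_add has_derivative_scaleR_right d s)
  then have "(vfield_rep A ?c (\<lambda>q. a *\<^sub>R s q + b *\<^sub>R s' q) has_derivative
      (\<lambda>v. a *\<^sub>R fderiv (vfield_rep A ?c s) (snd ?c p) v + b *\<^sub>R fderiv (vfield_rep A ?c s') (snd ?c p) v))
      (at (snd ?c p))"
    by (rule has_derivative_transform_within_open[OF _ open_cod[OF base_chart(1)] base_cod])
       (auto simp: base_chart linear_add[OF linear_tcoord] linear_scale[OF linear_tcoord])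
  from lie_bracket_eq[OF this d[OF t]] show ?thesis
    by (simp add: lie_bracket_eq[OF d[OF s(1)] d[OF t]] lie_bracket_eq[OF d[OF s(2)] d[OF t]]
        blinfun.bilinear_simps algebra_simps)
qed

lemma lie_bracket_Leibniz:
  assumes s: "smooth_section A (tangent_bundle A) s" and t: "smooth_section A (tangent_bundle A) t"
    and \<phi>: "smooth_map_on A UNIV \<phi>"
  shows "lie_bracket A s (\<lambda>q. \<phi> q *\<^sub>R t q) p
    = \<phi> p *\<^sub>R lie_bracket A s t p + differential A \<phi> p (s p) *\<^sub>R t p"
proof -
  let ?c = "base_chart A p"
  note d = vfield_rep_derivative
  have "smooth_on (snd ?c ` fst ?c) (\<phi> \<circ> chart_inv ?c)"
    using \<phi> base_chart(1) unfolding smooth_map_on_def by fastforce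
  then have d\<phi>: "(\<phi> \<circ> chart_inv ?c has_derivative differential A \<phi> p) (at (snd ?c p))"
    using smooth_on_has_derivative base_cod unfolding differential_def Let_def fderiv_def by blast
  have "((\<lambda>x. (\<phi> \<circ> chart_inv ?c) x *\<^sub>R vfield_rep A ?c t x) has_derivative
      (\<lambda>v. (\<phi> \<circ> chart_inv ?c) (snd ?c p) *\<^sub>R fderiv (vfield_rep A ?c t) (snd ?c p) v
        + differential A \<phi> p v *\<^sub>R vfield_rep A ?c t (snd ?c p))) (at (snd ?c p))"
    by (rule bounded_bilinear.FDERIV[OF bounded_bilinear_scaleR d\<phi> d[OF t]])
  then have "((\<lambda>x. (\<phi> \<circ> chart_inv ?c) x *\<^sub>R vfield_rep A ?c t x) has_derivative
      (\<lambda>v. \<phi> p *\<^sub>R fderiv (vfield_rep A ?c t) (snd ?c p) v + differential A \<phi> p v *\<^sub>R t p)) (at (snd ?c p))"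
    by (simp add: base_chart)
  then have "(vfield_rep A ?c (\<lambda>q. \<phi> q *\<^sub>R t q) has_derivative
      (\<lambda>v. \<phi> p *\<^sub>R fderiv (vfield_rep A ?c t) (snd ?c p) v + differential A \<phi> p v *\<^sub>R t p)) (at (snd ?c p))"
    by (rule has_derivative_transform_within_open[OF _ open_cod[OF base_chart(1)] base_cod])
       (auto simp: base_chart linear_scale[OF linear_tcoord])
  from lie_bracket_eq[OF d[OF s] this] show ?thesis
    by (simp add: lie_bracket_eq[OF d[OF s] d[OF t]] blinfun.bilinear_simps algebra_simps)
qed

lemma vfield_rep_lie_bracket:
  assumes "smooth_section A (tangent_bundle A) X" "smooth_section A (tangent_bundle A) Y"
    and c: "c \<in> A" and x: "x \<in> snd c ` fst c"
  shows "vfield_rep A c (lie_bracket A X Y) x = eucl_bracket (vfield_rep A c X) (vfield_rep A c Y) x"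
  using x c by (auto simp: lie_bracket_chart[OF assms(1,2)])

lemma smooth_section_lie_bracket:
  assumes X: "smooth_section A (tangent_bundle A) X" and Y: "smooth_section A (tangent_bundle A) Y"
  shows "smooth_section A (tangent_bundle A) (lie_bracket A X Y)"
  unfolding smooth_section_tangent_iff
proof
  fix c assume c: "c \<in> A"
  have "smooth_on (snd c ` fst c) (eucl_bracket (vfield_rep A c X) (vfield_rep A c Y))"
    using X Y c smooth_section_tangent_iff by (intro smooth_on_eucl_bracket open_cod) blast+
  then show "smooth_on (snd c ` fst c) (vfield_rep A c (lie_bracket A X Y))"
    by (rule smooth_on_cong[OF open_cod[OF c], rotated]) (simp add: vfield_rep_lie_bracket[OF X Y c])
qed

lemma lie_bracket_Jacobi:
  assumes X: "smooth_section A (tangent_bundle A) X" and Y: "smooth_section A (tangent_bundle A) Y"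
    and Z: "smooth_section A (tangent_bundle A) Z"
  shows "lie_bracket A X (lie_bracket A Y Z) p + lie_bracket A Y (lie_bracket A Z X) p
    + lie_bracket A Z (lie_bracket A X Y) p = 0"
proof -
  let ?c = "base_chart A p"
  let ?r = "vfield_rep A ?c"
  have sm: "smooth_on (snd ?c ` fst ?c) (?r X)" if "smooth_section A (tangent_bundle A) X" for X
    using that smooth_section_tangent_iff base_chart by blast
  have *: "lie_bracket A X (lie_bracket A Y Z) p = eucl_bracket (?r X) (eucl_bracket (?r Y) (?r Z)) (snd ?c p)"
    if X: "smooth_section A (tangent_bundle A) X" and Y: "smooth_section A (tangent_bundle A) Y"
      and Z: "smooth_section A (tangent_bundle A) Z" for X Y Z
  proof -
    have "lie_bracket A X (lie_bracket A Y Z) p = eucl_bracket (?r X) (?r (lie_bracket A Y Z)) (snd ?c p)"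
      using lie_bracket_chart[OF X smooth_section_lie_bracket[OF Y Z] base_chart(1) base_chart(2)[of p]] by simp
    also have "\<dots> = eucl_bracket (?r X) (eucl_bracket (?r Y) (?r Z)) (snd ?c p)"
      by (rule eucl_bracket_cong[OF open_cod[OF base_chart(1)] base_cod])
         (simp_all add: vfield_rep_lie_bracket[OF Y Z] base_chart smooth_on_eucl_bracket sm Y Z open_cod)
    finally show ?thesis .
  qed
  show ?thesis
    unfolding *[OF X Y Z] *[OF Y Z X] *[OF Z X Y]
    by (rule eucl_bracket_Jacobi[OF open_cod[OF base_chart(1)] base_cod sm[OF X] sm[OF Y] sm[OF Z]])
qed

lemma lie_algebroid_tangent: "lie_algebroid A (tangent_bundle A, \<lambda>p. id, lie_bracket A)"
proof -
  have m: "vb_morphism A (tangent_bundle A) (tangent_bundle A) (\<lambda>p. id)"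
    unfolding vb_morphism_def tangent_bundle_def
    by (auto simp: linear_id intro: smooth_tangent_transition)
  have skew: "lie_bracket A s t p = - lie_bracket A t s p" for s t p
    by (simp add: lie_bracket_def Let_def)
  have leib: "lie_bracket A s (\<lambda>q. \<phi> q *\<^sub>R t q) p
      = \<phi> p *\<^sub>R lie_bracket A s t p + differential A \<phi> p (id (s p)) *\<^sub>R t p"
    if "smooth_section A (tangent_bundle A) s" "smooth_section A (tangent_bundle A) t"
      "smooth_map_on A UNIV \<phi>" for s t \<phi> p
    using lie_bracket_Leibniz[OF that] by simp
  show ?thesis
    unfolding lie_algebroid.simps skew_algebroid.simps
    by (intro conjI allI impI)
       (rule vector_bundle_tangent m skew |
        (rule smooth_section_lie_bracket lie_bracket_lincomb leib lie_bracket_Jacobi; assumption))+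
qed

text \<open>Each axiom is an equation in a fibre of \<open>E\<close>; after applying the injective map \<open>F p\<close> it becomes
  the corresponding axiom of \<open>E'\<close> for the sections \<open>F s\<close>.\<close>

lemma lie_algebroid_transport:
  assumes L: "lie_algebroid A (E', \<rho>', br')"
    and E: "vector_bundle A E" "vb_morphism A E (tangent_bundle A) \<rho>"
    and F: "\<And>p. linear (F p)" "\<And>p. inj (F p)"
    and anchor: "\<And>p e. \<rho>' p (F p e) = \<rho> p e"
    and sec: "\<And>s. smooth_section A E s \<longleftrightarrow> smooth_section A E' (\<lambda>q. F q (s q))"
    and br: "\<And>s t p. smooth_section A E s \<Longrightarrow> smooth_section A E t \<Longrightarrow>
      F p (br s t p) = br' (\<lambda>q. F q (s q)) (\<lambda>q. F q (t q)) p"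
  shows "lie_algebroid A (E, \<rho>, br)"
proof -
  let ?G = "\<lambda>s q. F q (s q)"
  note lin = linear_add[OF F(1)] linear_scale[OF F(1)] linear_neg[OF F(1)] linear_0[OF F(1)]
  have eqI: "u = v" if "F p u = F p v" for p u v using F(2) that by (simp add: inj_eq)
  note S = sec[THEN iffD1]
  note L' = L[unfolded lie_algebroid.simps skew_algebroid.simps]
  note K = L'[THEN conjunct1, THEN conjunct2, THEN conjunct2]
  note closed = K[THEN conjunct1, rule_format]
  note skew = K[THEN conjunct2, THEN conjunct1, rule_format]
  note bil = K[THEN conjunct2, THEN conjunct2, THEN conjunct1, rule_format]
  note leib = K[THEN conjunct2, THEN conjunct2, THEN conjunct2, rule_format]
  note jac = L'[THEN conjunct2, rule_format]
  have Gbr: "?G (br s t) = br' (?G s) (?G t)" if "smooth_section A E s" "smooth_section A E t" for s t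
    using br[OF that] by blast
  have closedE: "smooth_section A E (br s t)" if "smooth_section A E s" "smooth_section A E t" for s t
    using closed[OF S S, OF that] by (subst sec) (simp only: Gbr[OF that])
  have skewE: "br s t p = - br t s p" if "smooth_section A E s" "smooth_section A E t" for s t p
    by (rule eqI[of p]) (simp add: lin br that skew[OF S S, OF that])
  have bilE: "br (\<lambda>q. a *\<^sub>R s q + b *\<^sub>R s' q) t p = a *\<^sub>R br s t p + b *\<^sub>R br s' t p"
    if s: "smooth_section A E s" "smooth_section A E s'" "smooth_section A E t" for s s' t a b p
    by (rule eqI[of p])
       (simp add: lin br s smooth_section_lincomb[OF E(1)] bil[OF S S S, OF s])
  have leibE: "br s (\<lambda>q. \<phi> q *\<^sub>R t q) p = \<phi> p *\<^sub>R br s t p + differential A \<phi> p (\<rho> p (s p)) *\<^sub>R t p"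
    if s: "smooth_section A E s" "smooth_section A E t" and \<phi>: "smooth_map_on A UNIV \<phi>" for s t \<phi> p
    by (rule eqI[of p])
       (simp add: lin br s smooth_section_scale[OF E(1) s(2) \<phi>] leib[OF S S \<phi>, OF s] anchor)
  have jacE: "br s (br t u) p + br t (br u s) p + br u (br s t) p = 0"
    if s: "smooth_section A E s" "smooth_section A E t" "smooth_section A E u" for s t u p
    by (rule eqI[of p])
       (simp add: lin br s closedE jac[OF S S S, OF s])
  show ?thesis
    unfolding lie_algebroid.simps skew_algebroid.simps
    by (intro conjI allI impI) (rule E | (rule closedE skewE bilE leibE jacE; assumption))+
qed

end


section \<open>The contact isomorphism in coordinates\<close>

text \<open>The coordinate expression of \<open>v \<mapsto> - i\<^sub>v d\<eta> + \<eta>(v) \<eta>\<close>.\<close>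

definition eucl_flat :: "('e::euclidean_space \<Rightarrow> 'e \<Rightarrow>\<^sub>L real) \<Rightarrow> 'e \<Rightarrow> 'e \<Rightarrow>\<^sub>L 'e \<Rightarrow>\<^sub>L real" where
  "eucl_flat e x = Blinfun (\<lambda>v. Blinfun (\<lambda>w. e x v * e x w - eucl_ext_deriv e x v w))"

lemma eucl_flat_apply: "eucl_flat e x v w = e x v * e x w - eucl_ext_deriv e x v w"
proof -
  have 1: "bounded_linear (\<lambda>w. e x v * e x w - eucl_ext_deriv e x v w)" for v
    unfolding eucl_ext_deriv_def linear_conv_bounded_linear[symmetric]
    by (rule linearI) (simp_all add: blinfun.bilinear_simps algebra_simps)
  have 2: "bounded_linear (\<lambda>v. Blinfun (\<lambda>w. e x v * e x w - eucl_ext_deriv e x v w))"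
    unfolding linear_conv_bounded_linear[symmetric]
    by (rule linearI; rule blinfun_eqI)
       (simp_all only: bounded_linear_Blinfun_apply[OF 1] plus_blinfun.rep_eq scaleR_blinfun.rep_eq,
        simp_all add: blinfun.bilinear_simps eucl_ext_deriv_def algebra_simps)
  show ?thesis
    unfolding eucl_flat_def by (simp add: bounded_linear_Blinfun_apply[OF 1] bounded_linear_Blinfun_apply[OF 2])
qed

lemma smooth_on_eucl_ext_deriv:
  assumes "open S" "smooth_on S e" "smooth_on S X" "smooth_on S Y"
  shows "smooth_on S (\<lambda>x. eucl_ext_deriv e x (X x) (Y x))"
  unfolding eucl_ext_deriv_def
  by (intro smooth_on_diff smooth_on_blinfun_apply smooth_on_fderiv assms)

lemma smooth_on_eucl_flat:
  assumes "open S" "smooth_on S e"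
  shows "smooth_on S (eucl_flat e)"
proof (rule smooth_on_blinfunI[OF assms(1)], rule smooth_on_blinfunI[OF assms(1)])
  fix v w
  have "smooth_on S (\<lambda>x. e x v *\<^sub>R e x w - eucl_ext_deriv e x v w)"
    by (intro smooth_on_diff smooth_on_scaleR smooth_on_blinfun_apply smooth_on_eucl_ext_deriv
        smooth_on_const assms)
  then show "smooth_on S (\<lambda>x. eucl_flat e x v w)" by (simp add: eucl_flat_apply)
qed

text \<open>The coordinate form of \<open>[\<flat> X, \<flat> Y] = \<flat> [X, Y]\<close>, the fields \<open>X - e(X) \<xi>\<close> and \<open>Y - e(Y) \<xi>\<close> being the
  images of the two one-forms under \<open>\<sharp>\<^sub>\<pi>\<close>. The derivatives of \<open>\<xi>\<close> cancel, and so do the second derivatives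
  of \<open>e\<close> because they are symmetric; what remains is an identity between values and first derivatives at \<open>x\<close>,
  which the Reeb conditions turn into a formal one.\<close>

lemma eucl_bracket_contact:
  fixes e :: "'e::euclidean_space \<Rightarrow> 'e \<Rightarrow>\<^sub>L real"
  assumes S: "open S" "x \<in> S" and e: "smooth_on S e"
    and X: "smooth_on S X" and Y: "smooth_on S Y" and \<xi>: "smooth_on S \<xi>"
    and reeb: "e x (\<xi> x) = 1" "\<And>w. eucl_ext_deriv e x (\<xi> x) w = 0"
    and a: "\<And>y. y \<in> S \<Longrightarrow> a y = eucl_flat e y (X y)"
    and b: "\<And>y. y \<in> S \<Longrightarrow> b y = eucl_flat e y (Y y)"
    and Za: "\<And>y. y \<in> S \<Longrightarrow> Za y = X y - e y (X y) *\<^sub>R \<xi> y"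
    and Zb: "\<And>y. y \<in> S \<Longrightarrow> Zb y = Y y - e y (Y y) *\<^sub>R \<xi> y"
    and p: "\<And>y. y \<in> S \<Longrightarrow> p y = eucl_ext_deriv e y (X y) (Y y)"
  shows "(fderiv b x (Za x) v + b x (fderiv Za x v)) - (fderiv a x (Zb x) v + a x (fderiv Zb x v))
      - fderiv p x v
      + e x (X x) * (fderiv b x (\<xi> x) v + b x (fderiv \<xi> x v) - b x v)
      - e x (Y x) * (fderiv a x (\<xi> x) v + a x (fderiv \<xi> x v) - a x v)
      - p x * e x v
    = eucl_flat e x (eucl_bracket X Y x) v"
proof -
  let ?E = "fderiv e x" and ?E2 = "fderiv (fderiv e) x"
  note D = smooth_on_has_derivative[OF _ S(2)] smooth_on_fderiv[OF S(1)]
  note de = D(1)[OF e] and d2e = D(1)[OF D(2)[OF e]]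
  note B = bounded_bilinear.FDERIV[OF bounded_bilinear_blinfun_apply]
  have flat: "fderiv b x u w = e x (Y x) * ?E u w + (e x (fderiv Y x u) + ?E u (Y x)) * e x w
      - (?E (fderiv Y x u) w + ?E2 u (Y x) w - (?E w (fderiv Y x u) + ?E2 u w (Y x)))"
    if Y: "smooth_on S Y" and b: "\<forall>y\<in>S. b y = eucl_flat e y (Y y)" for b Y u w
  proof -
    have db: "(b has_derivative fderiv b x) (at x)"
    proof (rule smooth_on_has_derivative[OF _ S(2)])
      have "smooth_on S (\<lambda>y. eucl_flat e y (Y y))"
        by (intro smooth_on_blinfun_apply smooth_on_eucl_flat S e Y)
      then show "smooth_on S b" by (rule smooth_on_cong[OF S(1), rotated]) (simp add: b)
    qed
    have "((\<lambda>y. b y w) has_derivative (\<lambda>u. fderiv b x u w)) (at x)"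
      by (rule bounded_linear.has_derivative[OF blinfun.bounded_linear_left db])
    then have 1: "fderiv (\<lambda>y. b y w) x u = fderiv b x u w" by (rule fderiv_apply_eqI)
    have "((\<lambda>y. e y (Y y) * e y w - (fderiv e y (Y y) w - fderiv e y w (Y y))) has_derivative
        (\<lambda>u. (e x (Y x) * (e x 0 + ?E u w) + (e x (fderiv Y x u) + ?E u (Y x)) * e x w)
          - (((?E (Y x) 0 + (?E (fderiv Y x u) + ?E2 u (Y x)) w))
            - (?E w (fderiv Y x u) + (?E 0 + ?E2 u w) (Y x))))) (at x)"
      by (intro has_derivative_diff has_derivative_mult B de d2e D(1)[OF Y] has_derivative_const)
    then have "fderiv (\<lambda>y. b y w) x u = (e x (Y x) * (e x 0 + ?E u w) + (e x (fderiv Y x u) + ?E u (Y x)) * e x w)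
          - (((?E (Y x) 0 + (?E (fderiv Y x u) + ?E2 u (Y x)) w))
            - (?E w (fderiv Y x u) + (?E 0 + ?E2 u w) (Y x)))"
      by (rule fderiv_apply_transform[OF _ S]) (simp add: b eucl_flat_apply eucl_ext_deriv_def)
    then show ?thesis unfolding 1 by (simp add: blinfun.bilinear_simps)
  qed
  have Z: "fderiv Za x u = fderiv X x u - (e x (X x) *\<^sub>R fderiv \<xi> x u + (e x (fderiv X x u) + ?E u (X x)) *\<^sub>R \<xi> x)"
    if X: "smooth_on S X" and Za: "\<forall>y\<in>S. Za y = X y - e y (X y) *\<^sub>R \<xi> y" for X Za u
  proof -
    have "((\<lambda>y. X y - e y (X y) *\<^sub>R \<xi> y) has_derivative
        (\<lambda>u. fderiv X x u - (e x (X x) *\<^sub>R fderiv \<xi> x u + (e x (fderiv X x u) + ?E u (X x)) *\<^sub>R \<xi> x))) (at x)"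
      by (intro has_derivative_diff bounded_bilinear.FDERIV[OF bounded_bilinear_scaleR] B de D(1)[OF X] D(1)[OF \<xi>])
    then show ?thesis by (rule fderiv_apply_transform[OF _ S]) (simp add: Za)
  qed
  have P: "fderiv p x u = (?E (X x) (fderiv Y x u) + (?E (fderiv X x u) + ?E2 u (X x)) (Y x))
      - (?E (Y x) (fderiv X x u) + (?E (fderiv Y x u) + ?E2 u (Y x)) (X x))" for u
  proof -
    have "((\<lambda>y. fderiv e y (X y) (Y y) - fderiv e y (Y y) (X y)) has_derivative
        (\<lambda>u. (?E (X x) (fderiv Y x u) + (?E (fderiv X x u) + ?E2 u (X x)) (Y x))
          - (?E (Y x) (fderiv X x u) + (?E (fderiv Y x u) + ?E2 u (Y x)) (X x)))) (at x)"
      by (intro has_derivative_diff B de d2e D(1)[OF X] D(1)[OF Y])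
    then show ?thesis by (rule fderiv_apply_transform[OF _ S]) (simp add: p eucl_ext_deriv_def)
  qed
  \<comment> \<open>The Reeb condition \<open>i\<^sub>\<xi> de = 0\<close>, oriented as a rewrite rule.\<close>
  have R: "?E w (\<xi> x) = ?E (\<xi> x) w" for w
    using reeb(2)[of w] by (simp add: eucl_ext_deriv_def)
  note sym = fderiv_fderiv_symmetric[OF S(1) e S(2)]
  have "\<forall>y\<in>S. a y = eucl_flat e y (X y)" "\<forall>y\<in>S. b y = eucl_flat e y (Y y)"
    and "\<forall>y\<in>S. Za y = X y - e y (X y) *\<^sub>R \<xi> y" "\<forall>y\<in>S. Zb y = Y y - e y (Y y) *\<^sub>R \<xi> y"
    using a b Za Zb by blast+
  note F = flat[OF X this(1)] flat[OF Y this(2)] Z[OF X this(3)] Z[OF Y this(4)]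
  show ?thesis
    unfolding F P a[OF S(2)] b[OF S(2)] Za[OF S(2)] Zb[OF S(2)] p[OF S(2)]
      eucl_flat_apply
    unfolding eucl_ext_deriv_def eucl_bracket_def
    by (simp add: blinfun.bilinear_simps R reeb(1) sym[of v "X x"] sym[of v "Y x"] sym[of "Y x" "X x"] algebra_simps)
qed


text \<open>The dual space has finite dimension but does not carry the type class of Euclidean spaces, so
  boundedness is read off from the expansion in the dual basis.\<close>

lemma linear_dual_imp_bounded_linear:
  fixes f :: "('e::euclidean_space \<Rightarrow>\<^sub>L real) \<Rightarrow> 'b::real_normed_vector"
  assumes "linear f"
  shows "bounded_linear f"
proof -
  have "(\<Sum>b\<in>Basis. blinfun_apply a b *\<^sub>R f (blinfun_inner_right b)) = f a" for a
    using arg_cong[OF dual_basis_expansion[of a], of f] by (simp add: linear_sum[OF assms] linear_scale[OF assms])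
  moreover have "bounded_linear (\<lambda>a. \<Sum>b\<in>Basis. blinfun_apply a b *\<^sub>R f (blinfun_inner_right b))"
    by (intro bounded_linear_sum bounded_linear_scaleR_left[THEN bounded_linear_compose] blinfun.bounded_linear_left)
  ultimately show ?thesis by presburger
qed

lemma linear_inv_of_bij:
  assumes f: "linear f" "bij f"
  shows "linear (inv f)"
proof (rule linearI)
  have r: "f (inv f z) = z" for z using f(2) by (simp add: bij_is_surj surj_f_inv_f)
  show "inv f (x + y) = inv f x + inv f y" for x y
    by (rule inv_f_eq[OF bij_is_inj[OF f(2)]]) (simp add: linear_add[OF f(1)] r)
  show "inv f (c *\<^sub>R x) = c *\<^sub>R inv f x" for c x
    by (rule inv_f_eq[OF bij_is_inj[OF f(2)]]) (simp add: linear_scale[OF f(1)] r)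
qed

text \<open>Composing with the Riesz isomorphism \<open>R\<close> gives an injective endomorphism of \<open>'e\<close>.\<close>

lemma inj_dual_imp_bij:
  fixes L :: "'e::euclidean_space \<Rightarrow> 'e \<Rightarrow>\<^sub>L real"
  assumes L: "linear L" and inj: "inj L"
  shows "bij L"
proof -
  define R where "R a = (\<Sum>b\<in>Basis. blinfun_apply a b *\<^sub>R b)" for a :: "'e \<Rightarrow>\<^sub>L real"
  have R: "R a \<bullet> b = a b" if "b \<in> Basis" for a b
    unfolding R_def by (subst inner_sum_left_Basis[OF that]) simp
  have injR: "a = a'" if "R a = R a'" for a a'
    by (rule blinfun_euclidean_eqI) (metis R that)
  have lin: "linear (\<lambda>v. R (L v))"
    unfolding R_def
    by (rule linearI) (simp_all add: linear_add[OF L] linear_scale[OF L] blinfun.bilinear_simps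
        scaleR_left_distrib sum.distrib scaleR_sum_right)
  have "inj (\<lambda>v. R (L v))"
    by (rule injI) (use injR inj in \<open>auto dest: injD\<close>)
  then have "surj (\<lambda>v. R (L v))" by (rule linear_injective_imp_surjective[OF lin _ refl])
  then have "\<exists>v. R a = R (L v)" for a by (meson surjD)
  then have "\<exists>v. a = L v" for a using injR by blast
  then show ?thesis using inj by (auto simp: bij_def surj_def)
qed

text \<open>The coordinate expression of \<open>\<sharp>\<^sub>\<eta>\<close>.\<close>

definition eucl_sharp :: "('e::euclidean_space \<Rightarrow> 'e \<Rightarrow>\<^sub>L real) \<Rightarrow> 'e \<Rightarrow> ('e \<Rightarrow>\<^sub>L real) \<Rightarrow>\<^sub>L 'e" where
  "eucl_sharp e x = Blinfun (inv (blinfun_apply (eucl_flat e x)))"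

lemma eucl_sharp_inverse:
  assumes "bij (blinfun_apply (eucl_flat e x))"
  shows "eucl_sharp e x (eucl_flat e x v) = v" "eucl_flat e x (eucl_sharp e x a) = a"
proof -
  have "linear (blinfun_apply (eucl_flat e x))"
    by (rule linearI) (simp_all add: blinfun.bilinear_simps)
  then have "bounded_linear (inv (blinfun_apply (eucl_flat e x)))"
    using assms by (intro linear_dual_imp_bounded_linear linear_inv_of_bij)
  then have "blinfun_apply (eucl_sharp e x) = inv (blinfun_apply (eucl_flat e x))"
    unfolding eucl_sharp_def by (rule bounded_linear_Blinfun_apply)
  then show "eucl_sharp e x (eucl_flat e x v) = v" "eucl_flat e x (eucl_sharp e x a) = a"
    using assms by (simp_all add: bij_is_inj bij_is_surj surj_f_inv_f)
qed

lemma smooth_on_eucl_sharp: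
  assumes "open S" "smooth_on S e" "\<And>x. x \<in> S \<Longrightarrow> bij (blinfun_apply (eucl_flat e x))"
  shows "smooth_on S (eucl_sharp e)"
  by (rule smooth_on_inverse_family[OF assms(1) smooth_on_eucl_flat[OF assms(1,2)]])
     (simp_all add: eucl_sharp_inverse assms(3))

section \<open>Contact manifolds\<close>

locale contact_manifold = atlas A
  for A :: "('m::{t2_space,second_countable_topology}, 'e::euclidean_space) chart set" +
  fixes \<eta> :: "('m, 'e) oneform" and n :: nat
  assumes dim: "DIM('e) = 2 * n + 1" and contact: "contact_form A n \<eta>"
begin

abbreviation "d\<eta> \<equiv> ext_deriv A \<eta>"
abbreviation "flat \<equiv> flat_contact A \<eta>"
abbreviation "sharp \<equiv> sharp_contact A \<eta>"
abbreviation "\<xi> \<equiv> reeb A \<eta>"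
abbreviation "\<pi> \<equiv> contact_biv A \<eta>"
abbreviation "\<eta>_rep c \<equiv> oneform_rep A c \<eta>"

lemma smooth_\<eta>: "smooth_section A (cotangent_bundle A) \<eta>"
  using contact by (simp add: contact_form_def)

lemma smooth_\<eta>_rep: "c \<in> A \<Longrightarrow> smooth_on (snd c ` fst c) (\<eta>_rep c)"
  using smooth_\<eta> smooth_section_cotangent_iff by blast

lemma d\<eta>_base: "d\<eta> p u v = eucl_ext_deriv (\<eta>_rep (base_chart A p)) (snd (base_chart A p) p) u v"
  using ext_deriv_chart[OF smooth_\<eta> base_chart] by simp

lemma linear_d\<eta>: "linear (d\<eta> p u)" "linear (\<lambda>u. d\<eta> p u v)"
  by (rule linearI; simp add: d\<eta>_base eucl_ext_deriv_def blinfun.bilinear_simps algebra_simps)+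

lemma d\<eta>_anti: "d\<eta> p v u = - d\<eta> p u v"
  by (simp add: d\<eta>_base eucl_ext_deriv_def)

lemma flat_apply: "flat p v w = \<eta> p v * \<eta> p w - d\<eta> p v w"
  unfolding flat_contact_def using linear_d\<eta>(1)[of p v]
  by (simp add: bounded_linear_Blinfun_apply linear_conv_bounded_linear blinfun.bilinear_simps)

lemma linear_flat: "linear (flat p)"
  by (rule linearI; rule blinfun_eqI)
     (simp_all add: flat_apply blinfun.bilinear_simps linear_add[OF linear_d\<eta>(2)]
       linear_scale[OF linear_d\<eta>(2)] algebra_simps)

lemma flat_chart:
  assumes c: "c \<in> A" "p \<in> fst c"
  shows "ctcoord A c p (flat p v) = eucl_flat (\<eta>_rep c) (snd c p) (tcoord A c p v)"
proof (rule blinfun_eqI)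
  fix w
  have w: "w = tcoord A c p (inv (tcoord A c p) w)" using c by simp
  show "ctcoord A c p (flat p v) w = eucl_flat (\<eta>_rep c) (snd c p) (tcoord A c p v) w"
    by (subst (1 2) w)
       (simp only: ctcoord_tcoord[OF c] eucl_flat_apply oneform_rep_at[OF c]
          ext_deriv_chart[OF smooth_\<eta> c, symmetric] flat_apply)
qed

text \<open>Nondegeneracy of the pair \<open>(\<eta>, d\<eta>)\<close>, the form in which the condition
  \<open>\<eta> \<and> (d\<eta>)\<^sup>n \<noteq> 0\<close> is used below.\<close>

lemma kernel_trivial:
  assumes "\<eta> p u = 0" "\<And>v. d\<eta> p u v = 0"
  shows "u = 0"
proof -
  obtain w where "wedge 1 (2 * n) (\<lambda>v. \<eta> p (v 0)) (wedge_power 2 (\<lambda>v. d\<eta> p (v 0) (v 1)) n) w \<noteq> 0"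
    using contact unfolding contact_form_def volume_form_def by blast
  moreover have "linear (blinfun_apply (\<eta> p))"
    by (rule linearI) (simp_all add: blinfun.bilinear_simps)
  moreover have "d\<eta> p v u = 0" for v using d\<eta>_anti[of p v u] assms(2) by simp
  ultimately show ?thesis
    using wedge_top_nonzero_imp_kernel_trivial[of n "blinfun_apply (\<eta> p)" "d\<eta> p" w u] dim linear_d\<eta> assms
    by auto
qed

text \<open>Since \<open>d\<eta>(v, v) = 0\<close>, evaluating \<open>\<flat> v = 0\<close> at \<open>v\<close> gives \<open>\<eta>(v)\<^sup>2 = 0\<close>, and then \<open>i\<^sub>v d\<eta> = 0\<close>.\<close>

lemma bij_flat: "bij (flat p)"
proof (rule inj_dual_imp_bij[OF linear_flat])
  have "v = 0" if "flat p v = 0" for v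
  proof -
    have *: "\<eta> p v * \<eta> p w = d\<eta> p v w" for w
      using flat_apply[of p v w] that by simp
    have "\<eta> p v * \<eta> p v = 0" using *[of v] d\<eta>_anti[of p v v] by simp
    then have "\<eta> p v = 0" by simp
    then show ?thesis using * by (intro kernel_trivial) auto
  qed
  then show "inj (flat p)" using linear_flat by (simp add: linear_injective_0)
qed

lemma sharp_flat [simp]: "sharp p (flat p v) = v"
  unfolding sharp_contact_def using bij_flat by (simp add: bij_is_inj)

lemma flat_sharp [simp]: "flat p (sharp p a) = a"
  unfolding sharp_contact_def using bij_flat by (simp add: bij_is_surj surj_f_inv_f)

lemma linear_sharp: "linear (sharp p)"
  unfolding sharp_contact_def using linear_flat bij_flat by (rule linear_inv_of_bij)

lemma bij_sharp: "bij (sharp p)"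
  unfolding sharp_contact_def using bij_flat by (rule bij_imp_bij_inv)

lemma inv_sharp: "inv (sharp p) = flat p"
  unfolding sharp_contact_def using bij_flat by (rule inv_inv_eq)

text \<open>The defining equation \<open>\<flat> \<xi> = \<eta>\<close> alone does not give \<open>\<eta>(\<xi>) = 1\<close>. In odd dimension \<open>d\<eta>\<close> has a
  nonzero kernel vector, on which \<open>\<eta>\<close> cannot vanish; scaled to \<open>\<eta>(z) = 1\<close> it satisfies \<open>\<flat> z = \<eta>\<close>, so it is \<open>\<xi>\<close>.\<close>

lemma reeb: "\<eta> p (\<xi> p) = 1" "d\<eta> p (\<xi> p) w = 0"
proof -
  have "\<exists>u. u \<noteq> 0 \<and> (\<forall>v. d\<eta> p u v = 0)"
    by (rule alternating_odd_dim_kernel[OF linear_d\<eta>(1) d\<eta>_anti]) (simp add: dim)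
  then obtain u where u: "u \<noteq> 0" "\<And>v. d\<eta> p u v = 0" by blast
  then have \<eta>u: "\<eta> p u \<noteq> 0" using kernel_trivial by blast
  define z where "z = (1 / \<eta> p u) *\<^sub>R u"
  have z: "\<eta> p z = 1" "d\<eta> p z v = 0" for v
    using \<eta>u u by (simp_all add: z_def blinfun.scaleR_right linear_scale[OF linear_d\<eta>(2)])
  then have "flat p z = \<eta> p" by (intro blinfun_eqI) (simp add: flat_apply)
  then have "\<xi> p = z" unfolding reeb_def using sharp_flat by metis
  then show "\<eta> p (\<xi> p) = 1" "d\<eta> p (\<xi> p) w = 0" using z by auto
qed

text \<open>For \<open>\<beta> = \<flat> w\<close> the equation \<open>\<beta>(Z) = \<pi>(\<flat> v, \<beta>)\<close> reads \<open>\<eta>(w) \<eta>(Z) - d\<eta>(w, Z) = d\<eta>(v, w)\<close>. The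
  vector \<open>Z = v - \<eta>(v) \<xi>\<close> solves it for all \<open>w\<close>, because \<open>\<eta>(Z) = 0\<close> and \<open>\<xi>\<close> is in the kernel of \<open>d\<eta>\<close>.\<close>

lemma sharp_biv_flat: "sharp_biv \<pi> p (flat p v) = v - \<eta> p v *\<^sub>R \<xi> p"
  unfolding sharp_biv_def
proof (rule the_equality)
  have *: "blinfun_apply b (v - \<eta> p v *\<^sub>R \<xi> p) = \<pi> p (flat p v) b" for b
  proof -
    have "flat p w (v - \<eta> p v *\<^sub>R \<xi> p) = d\<eta> p v w" for w
      using reeb[of p] d\<eta>_anti[of p w "\<xi> p"] d\<eta>_anti[of p w v]
      by (simp add: flat_apply blinfun.bilinear_simps linear_diff[OF linear_d\<eta>(1)] linear_scale[OF linear_d\<eta>(1)])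
    from this[of "sharp p b"] show ?thesis by (simp add: contact_biv_def)
  qed
  then show "\<forall>b. blinfun_apply b (v - \<eta> p v *\<^sub>R \<xi> p) = \<pi> p (flat p v) b" by blast
  fix v' assume "\<forall>b. blinfun_apply b v' = \<pi> p (flat p v) b"
  then have "blinfun_apply b v' = blinfun_apply b (v - \<eta> p v *\<^sub>R \<xi> p)"
    for b :: "'e \<Rightarrow>\<^sub>L real" using * by simp
  then have "v' \<bullet> i = (v - \<eta> p v *\<^sub>R \<xi> p) \<bullet> i" for i
    by (metis blinfun_inner_right.rep_eq inner_commute)
  then show "v' = v - \<eta> p v *\<^sub>R \<xi> p" by (rule euclidean_eqI)
qed

lemma sharp_jac_eq_sharp: "sharp_jac \<pi> \<xi> = sharp"
proof (intro ext)
  fix p a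
  have "sharp_jac \<pi> \<xi> p (flat p v) = v" for v
    unfolding sharp_jac_def sharp_biv_flat
    using reeb[of p] d\<eta>_anti[of p "\<xi> p"] by (simp add: flat_apply)
  from this[of "sharp p a"] show "sharp_jac \<pi> \<xi> p a = sharp p a" by simp
qed

lemma bij_eucl_flat:
  assumes "c \<in> A" "x \<in> snd c ` fst c"
  shows "bij (blinfun_apply (eucl_flat (\<eta>_rep c) x))"
proof -
  obtain p where p: "p \<in> fst c" "x = snd c p" using assms(2) by blast
  have "blinfun_apply (eucl_flat (\<eta>_rep c) x) = ctcoord A c p \<circ> flat p \<circ> inv (tcoord A c p)"
    using flat_chart[OF assms(1) p(1)] tcoord_inv[OF assms(1) p(1)] p by (auto simp: fun_eq_iff)
  then show ?thesis
    using bij_ctcoord[OF assms(1) p(1)] bij_flat bij_tcoord[OF assms(1) p(1)]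
    by (simp add: bij_comp bij_imp_bij_inv)
qed

lemma sharp_chart:
  assumes c: "c \<in> A" "p \<in> fst c"
  shows "tcoord A c p (sharp p a) = eucl_sharp (\<eta>_rep c) (snd c p) (ctcoord A c p a)"
  using flat_chart[OF c, of "sharp p a"] c by (simp add: eucl_sharp_inverse bij_eucl_flat)

lemma smooth_flat:
  assumes "c \<in> A" shows "smooth_on (snd c ` fst c) (eucl_flat (\<eta>_rep c))"
  using assms by (intro smooth_on_eucl_flat open_cod smooth_\<eta>_rep)

lemma smooth_sharp:
  assumes "c \<in> A" shows "smooth_on (snd c ` fst c) (eucl_sharp (\<eta>_rep c))"
  using assms by (intro smooth_on_eucl_sharp open_cod smooth_\<eta>_rep bij_eucl_flat)

lemma oneform_rep_flat:
  "c \<in> A \<Longrightarrow> x \<in> snd c ` fst c \<Longrightarrow>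
    oneform_rep A c (\<lambda>q. flat q (X q)) x = eucl_flat (\<eta>_rep c) x (vfield_rep A c X x)"
  by (auto simp: flat_chart)

lemma vfield_rep_sharp:
  "c \<in> A \<Longrightarrow> x \<in> snd c ` fst c \<Longrightarrow>
    vfield_rep A c (\<lambda>q. sharp q (\<alpha> q)) x = eucl_sharp (\<eta>_rep c) x (oneform_rep A c \<alpha> x)"
  by (auto simp: sharp_chart)

lemma smooth_section_flat:
  assumes X: "smooth_section A (tangent_bundle A) X"
  shows "smooth_section A (cotangent_bundle A) (\<lambda>q. flat q (X q))"
  unfolding smooth_section_cotangent_iff
proof
  fix c assume c: "c \<in> A"
  have "smooth_on (snd c ` fst c) (\<lambda>x. eucl_flat (\<eta>_rep c) x (vfield_rep A c X x))"
    using X c smooth_section_tangent_iff by (intro smooth_on_blinfun_apply smooth_flat open_cod) blast+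
  then show "smooth_on (snd c ` fst c) (oneform_rep A c (\<lambda>q. flat q (X q)))"
    by (rule smooth_on_cong[OF open_cod[OF c], rotated]) (simp add: oneform_rep_flat c)
qed

lemma smooth_section_sharp:
  assumes \<alpha>: "smooth_section A (cotangent_bundle A) \<alpha>"
  shows "smooth_section A (tangent_bundle A) (\<lambda>q. sharp q (\<alpha> q))"
  unfolding smooth_section_tangent_iff
proof
  fix c assume c: "c \<in> A"
  have "smooth_on (snd c ` fst c) (\<lambda>x. eucl_sharp (\<eta>_rep c) x (oneform_rep A c \<alpha> x))"
    using \<alpha> c smooth_section_cotangent_iff by (intro smooth_on_blinfun_apply smooth_sharp open_cod) blast+
  then show "smooth_on (snd c ` fst c) (vfield_rep A c (\<lambda>q. sharp q (\<alpha> q)))"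
    by (rule smooth_on_cong[OF open_cod[OF c], rotated]) (simp add: vfield_rep_sharp c)
qed

lemma smooth_section_sharp_iff:
  "smooth_section A (cotangent_bundle A) \<alpha> \<longleftrightarrow> smooth_section A (tangent_bundle A) (\<lambda>q. sharp q (\<alpha> q))"
  using smooth_section_sharp smooth_section_flat[of "\<lambda>q. sharp q (\<alpha> q)"] by auto

lemma smooth_section_reeb: "smooth_section A (tangent_bundle A) \<xi>"
  unfolding reeb_def[abs_def] by (rule smooth_section_sharp[OF smooth_\<eta>])

text \<open>Used to pass from the transition functions of a bundle to the local expressions of a morphism,
  which differ by the coordinate matrix \<open>G\<close> of the morphism.\<close>

lemma smooth_map_on_blinfun_apply:
  assumes c: "c \<in> A" and W: "open W" "W \<subseteq> fst c"
    and G: "smooth_on (snd c ` fst c) G" and f: "smooth_map_on A W f"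
    and g: "\<And>p. p \<in> W \<Longrightarrow> g p = blinfun_apply (G (snd c p)) (f p)"
  shows "smooth_map_on A W g"
proof (rule smooth_map_onI[OF c W])
  have "open (snd c ` W)" using open_chart_image[OF c W(1)] W(2) by (simp add: Int_absorb1)
  then show "smooth_on (snd c ` W) (\<lambda>x. G x ((f \<circ> chart_inv c) x))"
    using f[unfolded smooth_map_on_chart[OF c W]] W(2)
    by (intro smooth_on_blinfun_apply smooth_on_mono[OF G]) (auto simp: comp_def)
  show "g p = G (snd c p) ((f \<circ> chart_inv c) (snd c p))" if "p \<in> W" for p
    using g[OF that] that W(2) c by auto
qed

lemma vb_isomorphism_sharp: "vb_isomorphism A (cotangent_bundle A) (tangent_bundle A) sharp"
proof -
  have 1: "smooth_map_on A (fst c \<inter> fst c') (\<lambda>p. tcoord A c' p (sharp p (inv (ctcoord A c p) w)))"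
    if "c \<in> A" "c' \<in> A" for c c' w
    by (rule smooth_map_on_blinfun_apply[OF that(2) open_overlap[OF that] _ smooth_sharp[OF that(2)]
          smooth_cotangent_transition[OF that, of w]])
       (use that in \<open>auto simp: sharp_chart\<close>)
  have 2: "smooth_map_on A (fst c \<inter> fst c') (\<lambda>p. ctcoord A c' p (flat p (inv (tcoord A c p) w)))"
    if "c \<in> A" "c' \<in> A" for c c' w
    by (rule smooth_map_on_blinfun_apply[OF that(2) open_overlap[OF that] _ smooth_flat[OF that(2)]
          smooth_tangent_transition[OF that, of w]])
       (use that in \<open>auto simp: flat_chart\<close>)
  show ?thesis
    unfolding vb_isomorphism_def vb_morphism_def inv_sharp tangent_bundle_def cotangent_bundle_def
    by (simp add: linear_sharp linear_flat bij_sharp 1 2)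
qed

lemma lie_deriv_apply:
  assumes "c = base_chart A p" "smooth_on (snd c ` fst c) (vfield_rep A c Z)" "smooth_on (snd c ` fst c) (oneform_rep A c \<beta>)"
  shows "lie_deriv A Z \<beta> p v = fderiv (oneform_rep A c \<beta>) (snd c p) (Z p) v + \<beta> p (fderiv (vfield_rep A c Z) (snd c p) v)"
proof -
  have x: "snd c p \<in> snd c ` fst c" using base_cod assms(1) by blast
  have "bounded_linear (\<lambda>v. fderiv (oneform_rep A c \<beta>) (snd c p) (Z p) v + \<beta> p (fderiv (vfield_rep A c Z) (snd c p) v))"
    by (intro bounded_linear_add blinfun.bounded_linear_right bounded_linear_compose[OF blinfun.bounded_linear_right])
  then show ?thesis
    unfolding lie_deriv_def Let_def assms(1)[symmetric] smooth_on_frechet_derivative[OF assms(2) x] smooth_on_frechet_derivative[OF assms(3) x]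
    by (simp add: bounded_linear_Blinfun_apply)
qed

text \<open>In the base chart of \<open>p\<close> each ingredient of the bracket becomes the corresponding Euclidean
  expression, on the whole chart domain and not only at \<open>p\<close>, so that it may be differentiated there.\<close>

lemma bracket_jac_flat:
  assumes X: "smooth_section A (tangent_bundle A) X" and Y: "smooth_section A (tangent_bundle A) Y"
  shows "bracket_jac A \<pi> \<xi> \<eta> (\<lambda>q. flat q (X q)) (\<lambda>q. flat q (Y q)) p = flat p (lie_bracket A X Y p)"
proof (rule blinfun_eqI)
  fix v
  define c where "c = base_chart A p"
  define S where "S = snd c ` fst c"
  define x where "x = snd c p"
  have c: "c \<in> A" "p \<in> fst c" and x: "x \<in> S" and S: "open S"
    using base_chart by (auto simp: c_def x_def S_def open_cod)
  let ?r = "vfield_rep A c" and ?e = "\<eta>_rep c"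
  let ?a = "\<lambda>q. flat q (X q)" and ?b = "\<lambda>q. flat q (Y q)"
  let ?Za = "\<lambda>q. sharp_biv \<pi> q (?a q)" and ?Zb = "\<lambda>q. sharp_biv \<pi> q (?b q)"
  let ?p = "(\<lambda>q. \<pi> q (?a q) (?b q)) \<circ> chart_inv c"
  have sm: "smooth_on S (?r X)" "smooth_on S (?r Y)" "smooth_on S (?r \<xi>)" "smooth_on S ?e"
    using X Y smooth_section_reeb smooth_section_tangent_iff smooth_\<eta>_rep c(1) unfolding S_def by blast+
  have sab: "smooth_on S (oneform_rep A c ?a)" "smooth_on S (oneform_rep A c ?b)"
    using smooth_section_flat[OF X] smooth_section_flat[OF Y] smooth_section_cotangent_iff c(1)
    unfolding S_def by blast+
  have at: "?r Z x = Z p" "oneform_rep A c \<alpha> x = \<alpha> p" for Z \<alpha>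
    using c unfolding x_def by (simp_all add: c_def)
  have Z: "?r (\<lambda>q. sharp_biv \<pi> q (flat q (X q))) y = ?r X y - ?e y (?r X y) *\<^sub>R ?r \<xi> y" if "y \<in> S" for y X
    using that c(1) unfolding S_def
    by (auto simp: sharp_biv_flat ctcoord_tcoord linear_diff[OF linear_tcoord] linear_scale[OF linear_tcoord])
  have P: "?p y = eucl_ext_deriv ?e y (?r X y) (?r Y y)" if "y \<in> S" for y
    using that c(1) unfolding S_def
    by (auto simp: contact_biv_def ext_deriv_chart[OF smooth_\<eta> c(1)])
  have sZ: "smooth_on S (?r (\<lambda>q. sharp_biv \<pi> q (flat q (X q))))" if X: "smooth_on S (?r X)" for X
  proof -
    have "smooth_on S (\<lambda>y. ?r X y - ?e y (?r X y) *\<^sub>R ?r \<xi> y)"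
      by (intro smooth_on_diff smooth_on_scaleR smooth_on_blinfun_apply S sm X)
    then show ?thesis by (rule smooth_on_cong[OF S, rotated]) (simp add: Z)
  qed
  have sP: "smooth_on S ?p"
  proof -
    have "smooth_on S (\<lambda>y. eucl_ext_deriv ?e y (?r X y) (?r Y y))"
      by (intro smooth_on_eucl_ext_deriv S sm)
    then show ?thesis by (rule smooth_on_cong[OF S, rotated]) (simp only: P)
  qed
  have L: "lie_deriv A Z \<beta> p v = fderiv (oneform_rep A c \<beta>) x (?r Z x) v + oneform_rep A c \<beta> x (fderiv (?r Z) x v)"
    if "smooth_on S (?r Z)" "smooth_on S (oneform_rep A c \<beta>)" for Z \<beta>
    using lie_deriv_apply[OF c_def that[unfolded S_def]] by (simp add: at x_def[symmetric])
  have d: "differential A (\<lambda>q. \<pi> q (?a q) (?b q)) p v = fderiv ?p x v"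
    unfolding differential_def Let_def c_def[symmetric] x_def[symmetric] fderiv_def ..
  have p: "?p x = \<pi> p (?a p) (?b p)" using c by (simp add: x_def)
  have reeb': "?e x (?r \<xi> x) = 1" "eucl_ext_deriv ?e x (?r \<xi> x) w = 0" for w
    using reeb[of p] d\<eta>_base[of p "\<xi> p" w] by (simp_all add: at c_def[symmetric] x_def[symmetric])
  have "bracket_jac A \<pi> \<xi> \<eta> ?a ?b p v =
      (fderiv (oneform_rep A c ?b) x (?r ?Za x) v + oneform_rep A c ?b x (fderiv (?r ?Za) x v))
      - (fderiv (oneform_rep A c ?a) x (?r ?Zb x) v + oneform_rep A c ?a x (fderiv (?r ?Zb) x v))
      - fderiv ?p x v
      + ?e x (?r X x) * (fderiv (oneform_rep A c ?b) x (?r \<xi> x) v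
          + oneform_rep A c ?b x (fderiv (?r \<xi>) x v) - oneform_rep A c ?b x v)
      - ?e x (?r Y x) * (fderiv (oneform_rep A c ?a) x (?r \<xi> x) v
          + oneform_rep A c ?a x (fderiv (?r \<xi>) x v) - oneform_rep A c ?a x v)
      - ?p x * ?e x v"
  proof -
    have "flat p (Z p) (\<xi> p) = ?e x (?r Z x)" for Z
      using reeb[of p] d\<eta>_anti[of p "\<xi> p"] by (simp add: flat_apply at)
    then show ?thesis
      unfolding bracket_jac_def bracket_biv_def p
      by (simp only: minus_blinfun.rep_eq plus_blinfun.rep_eq scaleR_blinfun.rep_eq real_scaleR_def
          L[OF sZ[OF sm(1)] sab(2)] L[OF sZ[OF sm(2)] sab(1)] L[OF sm(3) sab(1)] L[OF sm(3) sab(2)] d at)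
  qed
  also have "\<dots> = eucl_flat ?e x (eucl_bracket (?r X) (?r Y) x) v"
    by (rule eucl_bracket_contact[OF S x sm(4,1,2,3) reeb'])
       (use Z P oneform_rep_flat[OF c(1)] in \<open>simp_all add: S_def\<close>)
  also have "eucl_bracket (?r X) (?r Y) x = lie_bracket A X Y p"
    using lie_bracket_chart[OF X Y c] by (simp add: c_def x_def)
  also have "eucl_flat ?e x (lie_bracket A X Y p) = flat p (lie_bracket A X Y p)"
    using flat_chart[OF c, of "lie_bracket A X Y p"] by (simp add: c_def x_def)
  finally show "bracket_jac A \<pi> \<xi> \<eta> ?a ?b p v = flat p (lie_bracket A X Y p) v" .
qed

lemma sharp_bracket_jac:
  assumes "smooth_section A (cotangent_bundle A) s" "smooth_section A (cotangent_bundle A) t"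
  shows "sharp p (bracket_jac A \<pi> \<xi> \<eta> s t p) = lie_bracket A (\<lambda>q. sharp q (s q)) (\<lambda>q. sharp q (t q)) p"
  using bracket_jac_flat[OF smooth_section_sharp[OF assms(1)] smooth_section_sharp[OF assms(2)], of p]
  by simp

lemma lie_algebroid_cotangent:
  "lie_algebroid A (cotangent_bundle A, sharp_jac \<pi> \<xi>, bracket_jac A \<pi> \<xi> \<eta>)"
  unfolding sharp_jac_eq_sharp
proof (rule lie_algebroid_transport[OF lie_algebroid_tangent vector_bundle_cotangent, where F = sharp])
  show "vb_morphism A (cotangent_bundle A) (tangent_bundle A) sharp"
    using vb_isomorphism_sharp by (simp add: vb_isomorphism_def)
qed (simp_all add: linear_sharp bij_sharp bij_is_inj smooth_section_sharp_iff[symmetric] sharp_bracket_jac)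

lemma algebroid_isomorphic_tangent:
  "algebroid_isomorphic A (cotangent_bundle A, sharp_jac \<pi> \<xi>, bracket_jac A \<pi> \<xi> \<eta>) (tangent_algebroid A)"
  unfolding sharp_jac_eq_sharp tangent_algebroid_def algebroid_isomorphic.simps
  using vb_isomorphism_sharp sharp_bracket_jac by (intro exI[of _ sharp]) simp

end

theorem proposition1p1:
  fixes A :: "('m::{t2_space,second_countable_topology}, 'e::euclidean_space) chart set"
    and \<eta> :: "'m \<Rightarrow> 'e \<Rightarrow>\<^sub>L real"
    and \<pi> :: "('m, 'e) bivector"
    and \<xi> :: "('m, 'e) vfield"
    and n :: nat
  assumes "smooth_atlas A"
    and "DIM('e) = 2 * n + 1"
    and "n \<ge> 1"
    and "contact_form A n \<eta>"
    and "\<pi> = contact_biv A \<eta>"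
    and "\<xi> = reeb A \<eta>"
  shows "lie_algebroid A (cotangent_bundle A, sharp_jac \<pi> \<xi>, bracket_jac A \<pi> \<xi> \<eta>) \<and>
         algebroid_isomorphic A
           (cotangent_bundle A, sharp_jac \<pi> \<xi>, bracket_jac A \<pi> \<xi> \<eta>) (tangent_algebroid A)"
proof -
  interpret contact_manifold A \<eta> n
    using assms by unfold_locales
  show ?thesis
    unfolding assms(5,6) using lie_algebroid_cotangent algebroid_isomorphic_tangent by blast
qed

end
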